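(* Let $d\ge 1$. Then the following holds. (i) For any point distribution $Z=\{z_1,\dots,z_N\}\subset\mathbb S^d$, $$\frac1{N^2}\sum_{i,j=1}^N d(z_i,z_j)\le\frac12.$$ (ii) For a given $N\in\mathbb N$, the sum in (i) is maximized by $Z$ (among all $N$-point distributions in $\mathbb S^d$) if and only if the following condition holds: for any $x\in\mathbb S^d$ such that the hyperplane $x^\perp$ contains no points of $Z$, the numbers of points of $Z$ on either side of $x^\perp$ differ by at most one, i.e. $$\big|\#(Z\cap H(x))-\#(Z\cap H(-x))\big|\le 1.$$ (iii) If $N$ is even, then $$\max_{\#Z=N}\frac1{N^2}\sum_{i,j=1}^N d(z_i,z_j)=\frac12,$$ and this maximum is achieved if and only if $Z$ is centrally symmetric. (iv) If $N$ is odd, then $$\max_{\#Z=N}\frac1{N^2}\sum_{i,j=1}^N d(z_i,z_j)=\frac12-\frac1{2N^2},$$ and this maximum is achieved if and only if $Z$ can be represented as a union $Z=Z_1\cup Z_2$, where $Z_1$ is centrally symmetric, while $Z_2$ lies on a two-dimensional linear subspace of $\mathbb R^{d+1}$ (i.e. on one great circle) and satisfies $$\frac1{M^2}\sum_{z_i,z_j\in Z_2}d(z_i,z_j)=\frac12-\frac1{2M^2},\qquad M=\#Z_2,$$ i.e. $Z_2$ is a maximizer of the sum of geodesic distances on $\mathbb S^1$.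
   Context: $\mathbb S^d\subset\mathbb R^{d+1}$ is the unit sphere and $d(x,y)=\frac1\pi\arccos(x\cdot y)$ is the geodesic distance normalized so that antipodal points are at distance $1$. For $x\in\mathbb S^d$, $H(x)=\{z\in\mathbb S^d:z\cdot x>0\}$ is the open hemisphere and $x^\perp=\{z\in\mathbb R^{d+1}: z\cdot x=0\}$. Point distributions $Z=\{z_1,\dots,z_N\}$ are finite collections in which points may be repeated (multisets); cardinalities $\#$, unions and sums are taken with multiplicity, and $Z$ is centrally symmetric if for every $x\in\mathbb S^d$ the number of points of $Z$ located at $x$ equals the number of points of $Z$ located at $-x$. $Z_1$ is allowed to be empty. *)

theory Defs
  imports "HOL-Analysis.Analysis" "HOL-Library.Multiset"
begin

text \<open>Normalised so that antipodal points are at distance 1; meant for unit vectors only.\<close>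

definition geodesic_dist :: "'a::euclidean_space \<Rightarrow> 'a \<Rightarrow> real" where
  "geodesic_dist x y = 1 / pi * arccos (x \<bullet> y)"

definition open_hemisphere :: "'a::euclidean_space \<Rightarrow> 'a set" where
  "open_hemisphere x = {z \<in> sphere 0 1. z \<bullet> x > 0}"

definition perp_hyperplane :: "'a::euclidean_space \<Rightarrow> 'a set" where
  "perp_hyperplane x = {z. z \<bullet> x = 0}"

definition point_distributions :: "nat \<Rightarrow> 'a::euclidean_space multiset set" where
  "point_distributions N = {Z. size Z = N \<and> set_mset Z \<subseteq> sphere 0 1}"

definition centrally_symmetric :: "'a::euclidean_space multiset \<Rightarrow> bool" where
  "centrally_symmetric Z \<longleftrightarrow> (\<forall>x \<in> sphere 0 1. count Z x = count Z (- x))"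

text \<open>The sums over a multiset count multiplicities, so for
  \<open>Z = {#z\<^sub>1, \<dots>, z\<^sub>N#}\<close> this is the double sum over all index pairs \<open>(i, j)\<close>,
  including \<open>i = j\<close>, divided by \<open>N\<^sup>2\<close>.\<close>

definition mean_geodesic_dist :: "'a::euclidean_space multiset \<Rightarrow> real" where
  "mean_geodesic_dist Z =
     1 / (real (size Z))\<^sup>2 * (\<Sum>x\<in>#Z. \<Sum>y\<in>#Z. geodesic_dist x y)"

definition is_maximum :: "'b::order set \<Rightarrow> 'b \<Rightarrow> bool" where
  "is_maximum S m \<longleftrightarrow> m \<in> S \<and> (\<forall>s \<in> S. s \<le> m)"

abbreviation is_maximizer :: "nat \<Rightarrow> 'a::euclidean_space multiset \<Rightarrow> bool" where
  "is_maximizer N \<equiv> is_arg_max mean_geodesic_dist (\<lambda>Z. Z \<in> point_distributions N)"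

end

theory Submission
  imports Defs "HOL-Probability.Probability_Measure"
begin

text \<open>
  For unit vectors, a random hyperplane \<open>x\<^sup>\<bottom>\<close> separates \<open>z\<close> and \<open>w\<close> with probability
  \<open>geodesic_dist z w\<close>, so the mean of \<open>sgn (z \<bullet> x) * sgn (w \<bullet> x)\<close> over the unit ball is
  \<open>1 - 2 * geodesic_dist z w\<close>. Summing over all pairs, the mean distance of \<open>N\<close> points equals
  \<open>1 / 2 - D / (2 * N\<^sup>2)\<close>, where \<open>D\<close> is the mean square of the signed count
  \<open>S x = (\<Sum>z\<in>#Z. sgn (z \<bullet> x))\<close>. Almost everywhere \<open>S x\<close> is an integer of the parity of \<open>N\<close>, so
  \<open>D\<close> is minimal exactly when \<open>\<bar>S x\<bar> \<le> 1\<close> for all generic \<open>x\<close>.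

  Crossing the hyperplane orthogonal to \<open>z\<close> changes \<open>S\<close> by twice the difference of the multiplicities
  of \<open>z\<close> and \<open>- z\<close>. For even \<open>N\<close> this difference must vanish; for odd \<open>N\<close> it is at most 1 in absolute
  value, and cancelling antipodal pairs leaves a set of simple points without antipodes. If the plane
  spanned by two of these contained no third one, the signed count would change by more than 2 near
  the orthogonal complement of that plane. Hence the Sylvester--Gallai theorem, applied in an affine
  chart, puts all remaining points on one great circle.
\<close>

subsection \<open>Orthogonal invariance of Lebesgue measure\<close>

lemma orthogonal_transformation_measurable:
  fixes R :: "'a::euclidean_space \<Rightarrow> 'a"
  assumes "orthogonal_transformation R"
  shows "R \<in> borel_measurable borel"
  using orthogonal_transformation_linear[OF assms]
  by (intro borel_measurable_continuous_onI linear_continuous_on linear_linear[THEN iffD2])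

text \<open>The library has this only for \<open>real ^ 'n\<close> with a well-ordered index type. Following the
  uniqueness proof for Haar measure, the integral of \<open>f (R x) * g (R x + y)\<close> over \<open>x\<close> and \<open>y\<close>,
  with \<open>f\<close> the indicator of the unit ball, is evaluated in both orders.\<close>

lemma nn_integral_lborel_orthogonal:
  fixes R :: "'a::euclidean_space \<Rightarrow> 'a"
  assumes R: "orthogonal_transformation R" and [measurable]: "g \<in> borel_measurable borel"
  shows "(\<integral>\<^sup>+ x. g (R x) \<partial>lborel) = (\<integral>\<^sup>+ x. g x \<partial>lborel)"
proof -
  have lin: "linear R" using R by (rule orthogonal_transformation_linear)
  note [measurable] = orthogonal_transformation_measurable[OF R]
  have translate: "(\<integral>\<^sup>+ x. h (c + x) \<partial>lborel) = (\<integral>\<^sup>+ x. h x \<partial>lborel)"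
    if [measurable]: "h \<in> borel_measurable borel" for h :: "'a \<Rightarrow> ennreal" and c
    by (subst (2) lborel_distr_plus[symmetric, of c], subst nn_integral_distr) auto
  have translateR: "(\<integral>\<^sup>+ x. h (R x) \<partial>lborel) = (\<integral>\<^sup>+ x. h (c + R x) \<partial>lborel)"
    if [measurable]: "h \<in> borel_measurable borel" for h :: "'a \<Rightarrow> ennreal" and c
  proof -
    obtain b where "R b = c"
      using orthogonal_transformation_surj[OF R] by (metis surjD)
    then have "h (c + R x) = h (R (b + x))" for x
      using linear_add[OF lin] by simp
    then show ?thesis
      using translate[of "\<lambda>x. h (R x)" b] by simp
  qed
  \<comment> \<open>The ball is invariant under \<open>R\<close> and under negation, and its measure
    \<open>C\<close> is positive and finite, so \<open>C\<close> cancels at the end.\<close>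
  define f :: "'a \<Rightarrow> ennreal" where "f = indicator (ball 0 1)"
  have [measurable]: "f \<in> borel_measurable borel" unfolding f_def by (intro borel_measurable_indicator borel_open open_ball)
  have fR: "f (R x) = f x" and fminus: "f (- x) = f x" for x
    using orthogonal_transformation_norm[OF R, of x]
    by (auto simp: f_def indicator_def)
  define C where "C = (\<integral>\<^sup>+ x. f x \<partial>lborel)"
  have C: "C = emeasure lborel (ball (0::'a) 1)" by (simp add: C_def f_def)
  have "C * (\<integral>\<^sup>+ y. g y \<partial>lborel) = (\<integral>\<^sup>+ x. f (R x) * (\<integral>\<^sup>+ y. g y \<partial>lborel) \<partial>lborel)"
    unfolding fR C_def by (rule nn_integral_multc[symmetric]) simp
  also have "\<dots> = (\<integral>\<^sup>+ x. f (R x) * (\<integral>\<^sup>+ y. g (R x + y) \<partial>lborel) \<partial>lborel)"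
    by (simp add: translate)
  also have "\<dots> = (\<integral>\<^sup>+ x. (\<integral>\<^sup>+ y. f (R x) * g (R x + y) \<partial>lborel) \<partial>lborel)"
    by (simp add: nn_integral_cmult)
  also have "\<dots> = (\<integral>\<^sup>+ y. (\<integral>\<^sup>+ x. f (R x) * g (R x + y) \<partial>lborel) \<partial>lborel)"
    by (rule lborel_pair.Fubini') measurable
  also have "\<dots> = (\<integral>\<^sup>+ y. (\<integral>\<^sup>+ x. f (- y + R x) * g (R x) \<partial>lborel) \<partial>lborel)"
  proof (rule nn_integral_cong)
    fix y
    show "(\<integral>\<^sup>+ x. f (R x) * g (R x + y) \<partial>lborel) = (\<integral>\<^sup>+ x. f (- y + R x) * g (R x) \<partial>lborel)"
      using translateR[of "\<lambda>x. f (- y + x) * g x" y] by (simp add: add.commute)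
  qed
  also have "\<dots> = (\<integral>\<^sup>+ x. (\<integral>\<^sup>+ y. f (- y + R x) * g (R x) \<partial>lborel) \<partial>lborel)"
    by (rule lborel_pair.Fubini') measurable
  also have "\<dots> = (\<integral>\<^sup>+ x. (\<integral>\<^sup>+ y. f (- R x + y) \<partial>lborel) * g (R x) \<partial>lborel)"
  proof (rule nn_integral_cong)
    fix x
    have "f (- y + R x) = f (- R x + y)" for y using fminus[of "- y + R x"] by simp
    then show "(\<integral>\<^sup>+ y. f (- y + R x) * g (R x) \<partial>lborel) = (\<integral>\<^sup>+ y. f (- R x + y) \<partial>lborel) * g (R x)"
      by (simp add: nn_integral_multc)
  qed
  also have "\<dots> = C * (\<integral>\<^sup>+ x. g (R x) \<partial>lborel)"
    unfolding C_def by (subst translate) (auto simp: nn_integral_cmult)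
  finally have eq: "C * (\<integral>\<^sup>+ y. g y \<partial>lborel) = C * (\<integral>\<^sup>+ x. g (R x) \<partial>lborel)" .
  have "C < \<infinity>" unfolding C by (rule emeasure_lborel_ball_finite)
  moreover have "C \<noteq> 0"
    unfolding C using unit_ball_vol_pos[of "DIM('a)"] by (simp add: emeasure_ball del: unit_ball_vol_pos)
  ultimately show ?thesis using eq by (auto simp: ennreal_mult_cancel_left)
qed

text \<open>Random directions are drawn from the solid ball: the integrands are built from signs of
  inner products with \<open>x\<close>, hence depend only on the direction of \<open>x\<close>, and
  the ball inherits its measure from \<open>lborel\<close>.\<close>

definition uniform_ball :: "'a::euclidean_space measure" where
  "uniform_ball = uniform_measure lborel (ball 0 1)"

lemma sets_uniform_ball [simp, measurable_cong]: "sets uniform_ball = sets borel"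
  by (simp add: uniform_ball_def)

lemma space_uniform_ball [simp]: "space uniform_ball = UNIV"
  by (simp add: uniform_ball_def)

lemma emeasure_unit_ball_pos: "emeasure lborel (ball (0::'a::euclidean_space) 1) \<noteq> 0"
  using unit_ball_vol_pos[of "DIM('a)"] by (simp add: emeasure_ball del: unit_ball_vol_pos)

lemma prob_space_uniform_ball: "prob_space (uniform_ball :: 'a::euclidean_space measure)"
  unfolding uniform_ball_def
  using emeasure_lborel_ball_finite[of "0::'a" 1]
  by (intro prob_space_uniform_measure emeasure_unit_ball_pos) (auto simp: less_top)

interpretation uniform_ball: prob_space "uniform_ball :: 'a::euclidean_space measure"
  by (rule prob_space_uniform_ball)

lemma measure_uniform_ball_UNIV [simp]: "measure (uniform_ball :: 'a::euclidean_space measure) UNIV = 1"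
  using uniform_ball.prob_space[where ?'a='a] by simp

text \<open>Both Lebesgue measure and the unit ball are invariant under \<open>R\<close>.\<close>

lemma distr_uniform_ball_orthogonal:
  fixes R :: "'a::euclidean_space \<Rightarrow> 'a"
  assumes R: "orthogonal_transformation R"
  shows "distr uniform_ball borel R = uniform_ball"
proof (rule measure_eqI)
  note [measurable] = orthogonal_transformation_measurable[OF R]
  fix A assume "A \<in> sets (distr uniform_ball borel R)"
  then have [measurable]: "A \<in> sets borel" by simp
  have ball: "indicator (ball 0 1 \<inter> R -` A) x = (indicator (ball 0 1 \<inter> A) (R x) :: ennreal)" for x
    using orthogonal_transformation_norm[OF R, of x] by (auto simp: indicator_def)
  have [measurable]: "R -` A \<in> sets borel"
    using measurable_sets[of R borel borel A] by simp
  have "emeasure lborel (ball 0 1 \<inter> R -` A) = (\<integral>\<^sup>+ x. indicator (ball 0 1 \<inter> A) (R x) \<partial>lborel)"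
    unfolding ball[symmetric] by simp
  also have "\<dots> = emeasure lborel (ball 0 1 \<inter> A)"
    by (subst nn_integral_lborel_orthogonal[OF R], measurable) auto
  finally show "emeasure (distr uniform_ball borel R) A = emeasure uniform_ball A"
    by (simp add: emeasure_distr uniform_ball_def)
qed simp

lemma AE_uniform_ball_iff:
  "(AE x in uniform_ball. P x) \<longleftrightarrow> (AE x in lborel. x \<in> ball (0::'a::euclidean_space) 1 \<longrightarrow> P x)"
  unfolding uniform_ball_def using emeasure_lborel_ball_finite[of "0::'a" 1]
  by (intro AE_uniform_measure emeasure_unit_ball_pos) auto

lemma AE_uniform_ball_inner_nonzero:
  fixes z :: "'a::euclidean_space"
  assumes "z \<noteq> 0"
  shows "AE x in uniform_ball. z \<bullet> x \<noteq> 0"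
proof -
  have "{x. z \<bullet> x = 0} \<in> null_sets lborel"
    using negligible_hyperplane[of z 0] assms
    by (simp add: negligible_iff_null_sets null_sets_completion_iff borel_closed closed_hyperplane)
  from AE_not_in[OF this] show ?thesis
    unfolding AE_uniform_ball_iff by eventually_elim auto
qed



subsection \<open>The geodesic distance as an averaged sign separation\<close>

text \<open>Nonnegativity makes \<open>g\<close> monotone, and additivity fixes it at the multiples
  of \<open>h = L / n\<close>. Between neighbouring multiples the deviation from the linear function
  is at most \<open>g h = g L / n\<close>.\<close>

lemma additive_nonneg_imp_linear:
  fixes g :: "real \<Rightarrow> real"
  assumes add: "\<And>a b. 0 \<le> a \<Longrightarrow> 0 \<le> b \<Longrightarrow> a + b \<le> L \<Longrightarrow> g (a + b) = g a + g b"
    and nonneg: "\<And>a. 0 \<le> a \<Longrightarrow> a \<le> L \<Longrightarrow> 0 \<le> g a"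
    and L: "0 < L" and t: "0 \<le> t" "t \<le> L"
  shows "g t = t / L * g L"
proof (rule ccontr)
  assume "g t \<noteq> t / L * g L"
  define e where "e = \<bar>g t - t / L * g L\<bar>"
  have "e > 0" using \<open>g t \<noteq> t / L * g L\<close> by (simp add: e_def)
  \<comment> \<open>This \<open>n\<close> makes the mesh error \<open>g L / n\<close> smaller than
    \<open>e\<close>.\<close>
  then obtain n where n: "g L < of_nat n * e"
    using reals_Archimedean3 by blast
  have "g L \<ge> 0" using nonneg[of L] L by simp
  with n \<open>e > 0\<close> have "n > 0" by (cases n) auto
  define h where "h = L / n"
  have h: "h > 0" "n * h = L" using L \<open>n > 0\<close> by (auto simp: h_def)
  have mono: "g a \<le> g b" if "0 \<le> a" "a \<le> b" "b \<le> L" for a b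
    using add[of a "b - a"] nonneg[of "b - a"] that by simp
  have g0: "g 0 = 0" using add[of 0 0] L by simp
  have mult: "g (real k * h) = k * g h" if "k * h \<le> L" for k
    using that
  proof (induction k)
    case (Suc k)
    have "real k * h \<le> L" using Suc.prems h by (simp add: algebra_simps)
    then show ?case using add[of "k * h" h] Suc h by (simp add: algebra_simps)
  qed (simp add: g0)
  have gL: "g L = n * g h" using mult[of n] h by simp
  have gh: "g h \<ge> 0" using nonneg[of h] h \<open>n > 0\<close> L by (simp add: h_def field_simps)
  define k where "k = nat \<lfloor>t / h\<rfloor>"
  have k: "k * h \<le> t" "t < (k + 1) * h"
  proof -
    have "real k \<le> t / h" "t / h < real k + 1" using t h by (auto simp: k_def)
    then show "k * h \<le> t" "t < (k + 1) * h" using h by (auto simp: field_simps)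
  qed
  have tL: "t / L * g L = t / h * g h"
    using h \<open>n > 0\<close> by (simp add: gL h_def)
  have "k * g h \<le> g t" using mult[of k] mono[of "k * h" t] k t h by simp
  moreover have "g t \<le> (k + 1) * g h"
  proof (cases "(k + 1) * h \<le> L")
    case True
    then show ?thesis using mult[of "k + 1"] mono[of t "(k + 1) * h"] k t by simp
  next
    case False
    \<comment> \<open>The next multiple \<open>(k + 1) * h\<close> lies beyond \<open>L\<close>,
      outside the range of \<open>mult\<close>; monotonicity up to \<open>L\<close> replaces
      it.\<close>
    then have "real n * h < real (k + 1) * h" using h by simp
    then have "n < k + 1" using h(1) by (simp only: mult_less_cancel_right_pos of_nat_less_iff)
    have "g t \<le> g L" using mono[of t L] t by simp
    also have "\<dots> \<le> (k + 1) * g h"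
      unfolding gL using gh \<open>n < k + 1\<close> by (intro mult_right_mono) auto
    finally show ?thesis .
  qed
  moreover have "k * g h \<le> t / h * g h" "t / h * g h \<le> (k + 1) * g h"
    using k h gh by (intro mult_right_mono; simp add: field_simps)+
  ultimately have "e \<le> g h" unfolding e_def tL by (simp add: algebra_simps abs_le_iff)
  then have "n * e \<le> n * g h" by (intro mult_left_mono) auto
  with n gL show False by simp
qed

lemma abs_sgn_le_1: "\<bar>sgn (r::real)\<bar> \<le> 1"
  by (simp add: sgn_real_def)

text \<open>For nonzero \<open>z\<close> and \<open>w\<close> this is twice the probability that the
  hyperplane orthogonal to a random \<open>x\<close> separates them, since the integrand is 0 or 2
  almost everywhere.\<close>

definition sign_separation :: "'a::euclidean_space \<Rightarrow> 'a \<Rightarrow> real" where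
  "sign_separation z w = (\<integral>x. \<bar>sgn (z \<bullet> x) - sgn (w \<bullet> x)\<bar> \<partial>uniform_ball)"

lemma integrable_sign_separation:
  "integrable (uniform_ball :: 'a::euclidean_space measure) (\<lambda>x. \<bar>sgn (z \<bullet> x) - sgn (w \<bullet> x)\<bar>)"
  by (rule uniform_ball.integrable_const_bound[where B=2]) (auto simp: sgn_real_def)

lemma sign_separation_orthogonal:
  fixes R :: "'a::euclidean_space \<Rightarrow> 'a"
  assumes R: "orthogonal_transformation R"
  shows "sign_separation (R z) (R w) = sign_separation z w"
proof -
  note [measurable] = orthogonal_transformation_measurable[OF R]
  have "sign_separation (R z) (R w) =
      (\<integral>x. \<bar>sgn (R z \<bullet> x) - sgn (R w \<bullet> x)\<bar> \<partial>distr uniform_ball borel R)"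
    by (simp add: sign_separation_def distr_uniform_ball_orthogonal[OF R])
  also have "\<dots> = (\<integral>x. \<bar>sgn (R z \<bullet> R x) - sgn (R w \<bullet> R x)\<bar> \<partial>uniform_ball)"
    by (rule integral_distr) measurable
  finally show ?thesis
    using R by (simp add: sign_separation_def orthogonal_transformation_def)
qed

text \<open>The sign of \<open>u t \<bullet> x\<close> changes at most once along a half circle, because \<open>u a\<close> is a
  nonnegative combination of \<open>u 0\<close> and \<open>u (a + b)\<close>.\<close>

lemma circle_point_between:
  fixes e1 e2 x :: "'a::real_inner"
  defines "u \<equiv> \<lambda>t. cos t *\<^sub>R e1 + sin t *\<^sub>R e2"
  assumes ab: "0 \<le> a" "0 \<le> b" "a + b \<le> pi" and pos: "u 0 \<bullet> x > 0" "u (a + b) \<bullet> x > 0"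
  shows "u a \<bullet> x \<ge> 0"
proof (cases "a + b = 0 \<or> a + b = pi")
  \<comment> \<open>At both ends of the half circle \<open>sin (a + b)\<close> vanishes and cannot
    be divided out. Either \<open>a = 0\<close>, or \<open>u pi = - u 0\<close> contradicts
    \<open>pos\<close>.\<close>
  case True
  then show ?thesis
  proof
    assume "a + b = 0"
    then have "a = 0" using ab by linarith
    then show ?thesis using pos by simp
  next
    assume "a + b = pi"
    then show ?thesis using pos by (simp add: u_def)
  qed
next
  case False
  then have s: "sin (a + b) > 0" using ab by (intro sin_gt_zero) auto
  have "sin (a + b) * (u a \<bullet> x) = sin b * (u 0 \<bullet> x) + sin a * (u (a + b) \<bullet> x)"
  proof -
    have cs: "cos a * (cos a * y) + sin a * (sin a * y) = y" for y
      using sin_cos_squared_add3[of a] by (metis distrib_right mult.assoc mult_1)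
    show ?thesis
      by (simp add: u_def sin_add cos_add inner_add_left algebra_simps) (rule cs)
  qed
  also have "\<dots> \<ge> 0" using ab pos by (intro add_nonneg_nonneg mult_nonneg_nonneg sin_ge_zero) auto
  finally show ?thesis using s by (simp add: zero_le_mult_iff)
qed

text \<open>By rotation invariance, and because signs change at most once, the separation is
  additive in the angle; being nonnegative, it is linear. The slope comes from
  \<open>t = pi\<close>, where antipodes are separated almost surely.\<close>

lemma sign_separation_circle:
  fixes e1 e2 :: "'a::euclidean_space"
  assumes e: "norm e1 = 1" "norm e2 = 1" "e1 \<bullet> e2 = 0" and t: "0 \<le> t" "t \<le> pi"
  shows "sign_separation e1 (cos t *\<^sub>R e1 + sin t *\<^sub>R e2) = 2 * t / pi"
proof -
  define u where "u = (\<lambda>t. cos t *\<^sub>R e1 + sin t *\<^sub>R e2)"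
  have ee: "e1 \<bullet> e1 = 1" "e2 \<bullet> e2 = 1" "e2 \<bullet> e1 = 0"
    using e by (auto simp: dot_square_norm inner_commute)
  have u_nz: "u t \<noteq> 0" for t
  proof
    assume "u t = 0"
    moreover have "u t \<bullet> u t = 1"
      unfolding u_def using ee e by (simp add: inner_add_left inner_add_right flip: power2_eq_square)
    ultimately show False by simp
  qed
  \<comment> \<open>\<open>R t\<close> is the rotation by \<open>t\<close> in the plane of
    \<open>e1\<close> and \<open>e2\<close>, fixing the orthogonal complement of that plane.\<close>
  define R where "R = (\<lambda>t x. x + ((cos t - 1) * (x \<bullet> e1) - sin t * (x \<bullet> e2)) *\<^sub>R e1
                         + (sin t * (x \<bullet> e1) + (cos t - 1) * (x \<bullet> e2)) *\<^sub>R e2)"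
  have R: "orthogonal_transformation (R t)" for t
    unfolding orthogonal_transformation_def
  proof (intro conjI allI)
    show "linear (R t)"
      by (rule linearI) (simp_all add: R_def algebra_simps inner_add_left)
    fix v w
    have cs: "sin t * sin t = 1 - cos t * cos t"
      using sin_squared_eq[of t] by (simp add: power2_eq_square)
    show "R t v \<bullet> R t w = v \<bullet> w"
      unfolding R_def
      apply (simp only: inner_add_left inner_add_right inner_scaleR_left inner_scaleR_right ee e(3))
      apply (simp only: inner_commute[of e1] inner_commute[of e2])
      using cs by algebra
  qed
  have Ru: "R s (u t) = u (s + t)" for s t
  proof -
    have "u t \<bullet> e1 = cos t" "u t \<bullet> e2 = sin t"
      using ee e by (auto simp: u_def inner_add_left)
    then show ?thesis
      unfolding R_def by (simp add: u_def cos_add sin_add algebra_simps)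
  qed
  define g where "g = (\<lambda>t. sign_separation (u 0) (u t))"
  have "g t = t / pi * g pi"
  proof (rule additive_nonneg_imp_linear)
    fix a b :: real assume ab: "0 \<le> a" "0 \<le> b" "a + b \<le> pi"
    have "g b = sign_separation (u a) (u (a + b))"
      using sign_separation_orthogonal[OF R[of a], of "u 0" "u b"] by (simp add: Ru g_def)
    moreover have "g (a + b) = g a + sign_separation (u a) (u (a + b))"
      unfolding g_def sign_separation_def
      unfolding Bochner_Integration.integral_add[OF integrable_sign_separation integrable_sign_separation, symmetric]
    proof (rule integral_cong_AE)
      show "AE x in uniform_ball. \<bar>sgn (u 0 \<bullet> x) - sgn (u (a + b) \<bullet> x)\<bar> =
          \<bar>sgn (u 0 \<bullet> x) - sgn (u a \<bullet> x)\<bar> + \<bar>sgn (u a \<bullet> x) - sgn (u (a + b) \<bullet> x)\<bar>"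
        using AE_uniform_ball_inner_nonzero[OF u_nz[of 0]] AE_uniform_ball_inner_nonzero[OF u_nz[of a]]
          AE_uniform_ball_inner_nonzero[OF u_nz[of "a + b"]]
      proof eventually_elim
        case (elim x)
        have "u a \<bullet> x \<ge> 0" if "u 0 \<bullet> x > 0" "u (a + b) \<bullet> x > 0"
          using circle_point_between[OF ab, of e1 e2 x] that unfolding u_def by blast
        moreover have "u a \<bullet> x \<le> 0" if "u 0 \<bullet> x < 0" "u (a + b) \<bullet> x < 0"
          using circle_point_between[OF ab, of e1 e2 "-x"] that unfolding u_def inner_minus_right
          by linarith
        ultimately show ?case using elim by (auto simp: sgn_real_def neq_iff)
      qed
    qed measurable
    ultimately show "g (a + b) = g a + g b" by simp
  qed (use t in \<open>auto simp: g_def sign_separation_def\<close>)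
  moreover have "g pi = 2"
  proof -
    have "g pi = (\<integral>x. 2 \<partial>(uniform_ball :: 'a measure))"
      unfolding g_def sign_separation_def
    proof (rule integral_cong_AE)
      show "AE x in uniform_ball. \<bar>sgn (u 0 \<bullet> x) - sgn (u pi \<bullet> x)\<bar> = 2"
        using AE_uniform_ball_inner_nonzero[OF u_nz[of 0]]
        by eventually_elim (auto simp: u_def sgn_real_def)
    qed measurable
    then show ?thesis by simp
  qed
  ultimately show ?thesis by (simp add: g_def u_def)
qed

lemma unit_vector_polar:
  fixes z w :: "'a::euclidean_space"
  assumes "norm z = 1" "norm w = 1" and dim: "DIM('a) \<ge> 2"
  obtains e where "norm e = 1" "z \<bullet> e = 0"
    "w = cos (arccos (z \<bullet> w)) *\<^sub>R z + sin (arccos (z \<bullet> w)) *\<^sub>R e"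
proof -
  define v where "v = w - (z \<bullet> w) *\<^sub>R z"
  have zz: "z \<bullet> z = 1" "w \<bullet> w = 1" using assms by (auto simp: dot_square_norm)
  have bound: "\<bar>z \<bullet> w\<bar> \<le> 1" using Cauchy_Schwarz_ineq2[of z w] assms by simp
  have zv: "z \<bullet> v = 0" by (simp add: v_def inner_diff_right zz)
  have "(norm v)\<^sup>2 = 1 - (z \<bullet> w)\<^sup>2"
    unfolding power2_norm_eq_inner v_def
    by (simp add: inner_diff_left inner_diff_right zz inner_commute[of w z] power2_eq_square)
  then have nv: "norm v = sqrt (1 - (z \<bullet> w)\<^sup>2)" by (metis norm_ge_zero real_sqrt_unique)
  have cs: "cos (arccos (z \<bullet> w)) = z \<bullet> w" "sin (arccos (z \<bullet> w)) = norm v"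
    using bound unfolding nv by (auto simp: abs_le_iff sin_arccos_abs)
  show ?thesis
  proof (cases "v = 0")
    \<comment> \<open>Here \<open>w\<close> is parallel to \<open>z\<close> and the sine coefficient
      vanishes, so any unit vector orthogonal to \<open>z\<close> will do; \<open>dim\<close>
      supplies one.\<close>
    case True
    obtain e where "e \<noteq> 0" "orthogonal z e"
      using orthogonal_to_vector_exists[OF dim] by blast
    then show ?thesis
      using True cs
      by (intro that[of "e /\<^sub>R norm e"]) (auto simp: orthogonal_def v_def)
  next
    case False
    then show ?thesis
      using cs zv by (intro that[of "v /\<^sub>R norm v"]) (auto simp: v_def)
  qed
qed

text \<open>Two signs \<open>s\<close> and \<open>t\<close>, each 1 or -1, satisfy
  \<open>s * t = 1 - |s - t|\<close>, so the mean product follows from the sign separation.\<close>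

lemma integral_sgn_inner_mult:
  fixes z w :: "'a::euclidean_space"
  assumes zw: "norm z = 1" "norm w = 1" and dim: "DIM('a) \<ge> 2"
  shows "(\<integral>x. sgn (z \<bullet> x) * sgn (w \<bullet> x) \<partial>uniform_ball) = 1 - 2 * geodesic_dist z w"
proof -
  obtain e where e: "norm e = 1" "z \<bullet> e = 0"
    "w = cos (arccos (z \<bullet> w)) *\<^sub>R z + sin (arccos (z \<bullet> w)) *\<^sub>R e"
    using unit_vector_polar[OF assms] .
  have "\<bar>z \<bullet> w\<bar> \<le> 1" using Cauchy_Schwarz_ineq2[of z w] zw by simp
  then have "sign_separation z w = 2 * arccos (z \<bullet> w) / pi"
    using sign_separation_circle[OF zw(1) e(1,2), of "arccos (z \<bullet> w)"] e(3)
    by (simp add: arccos_lbound arccos_ubound)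
  moreover have "(\<integral>x. sgn (z \<bullet> x) * sgn (w \<bullet> x) \<partial>uniform_ball) =
      (\<integral>x. 1 - \<bar>sgn (z \<bullet> x) - sgn (w \<bullet> x)\<bar> \<partial>uniform_ball)"
  proof (rule integral_cong_AE)
    have "z \<noteq> 0" "w \<noteq> 0" using zw by auto
    from this[THEN AE_uniform_ball_inner_nonzero]
    show "AE x in uniform_ball. sgn (z \<bullet> x) * sgn (w \<bullet> x) = 1 - \<bar>sgn (z \<bullet> x) - sgn (w \<bullet> x)\<bar>"
      by eventually_elim (auto simp: sgn_real_def)
  qed measurable
  moreover have "\<dots> = 1 - sign_separation z w"
    unfolding sign_separation_def
    by (subst Bochner_Integration.integral_diff)
       (use integrable_sign_separation in auto)
  ultimately show ?thesis by (simp add: geodesic_dist_def)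
qed

section \<open>Signed counts and their mean square\<close>

lemma
  fixes f :: "'b \<Rightarrow> 'a \<Rightarrow> real"
  assumes "\<And>z. z \<in># Z \<Longrightarrow> integrable M (f z)"
  shows integrable_sum_mset: "integrable M (\<lambda>x. \<Sum>z\<in>#Z. f z x)"
    and integral_sum_mset: "(\<integral>x. (\<Sum>z\<in>#Z. f z x) \<partial>M) = (\<Sum>z\<in>#Z. \<integral>x. f z x \<partial>M)"
  using assms by (induction Z) auto

definition signed_count :: "'a::real_inner multiset \<Rightarrow> 'a \<Rightarrow> real" where
  "signed_count Z x = (\<Sum>z\<in>#Z. sgn (z \<bullet> x))"

lemma signed_count_empty [simp]: "signed_count {#} x = 0"
  by (simp add: signed_count_def)

lemma signed_count_add_mset [simp]: "signed_count (add_mset z Z) x = sgn (z \<bullet> x) + signed_count Z x"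
  by (simp add: signed_count_def)

lemma signed_count_union [simp]: "signed_count (Y + Z) x = signed_count Y x + signed_count Z x"
  by (simp add: signed_count_def)

lemma signed_count_measurable [measurable]:
  "signed_count Z \<in> borel_measurable (borel :: 'a::euclidean_space measure)"
proof (induction Z)
  case (add z Z)
  note this [measurable]
  show ?case unfolding signed_count_add_mset by measurable
qed simp

lemma abs_signed_count_le: "\<bar>signed_count Z x\<bar> \<le> size Z"
proof (induction Z)
  case (add z Z)
  show ?case
    using add abs_sgn_le_1[of "z \<bullet> x"] abs_triangle_ineq[of "sgn (z \<bullet> x)" "signed_count Z x"]
    by (simp only: signed_count_add_mset size_add_mset of_nat_Suc)
qed simp

definition discrepancy :: "'a::euclidean_space multiset \<Rightarrow> real" where
  "discrepancy Z = (\<integral>x. (signed_count Z x)\<^sup>2 \<partial>uniform_ball)"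

lemma integrable_signed_count_sq:
  "integrable (uniform_ball :: 'a::euclidean_space measure) (\<lambda>x. (signed_count Z x)\<^sup>2)"
  using abs_signed_count_le[of Z]
  by (intro uniform_ball.integrable_const_bound[where B="(real (size Z))\<^sup>2"])
     (auto simp: abs_le_square_iff[symmetric])

text \<open>An identity of Stolarsky type, obtained by expanding the square and integrating each
  product of signs.\<close>

lemma discrepancy_eq:
  fixes Z :: "'a::euclidean_space multiset"
  assumes Z: "set_mset Z \<subseteq> sphere 0 1" and dim: "DIM('a) \<ge> 2"
  shows "discrepancy Z = (real (size Z))\<^sup>2 - 2 * (\<Sum>x\<in>#Z. \<Sum>y\<in>#Z. geodesic_dist x y)"
proof -
  have int: "integrable uniform_ball (\<lambda>x::'a. sgn (z \<bullet> x) * sgn (w \<bullet> x))" for z w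
    by (rule uniform_ball.integrable_const_bound[where B=1])
       (auto simp: abs_mult intro!: mult_le_one abs_sgn_le_1)
  have "discrepancy Z = (\<integral>x. (\<Sum>z\<in>#Z. \<Sum>w\<in>#Z. sgn (z \<bullet> x) * sgn (w \<bullet> x)) \<partial>uniform_ball)"
    by (simp add: discrepancy_def signed_count_def power2_eq_square sum_mset_distrib_right) (simp add: sum_mset_distrib_left)
  also have "\<dots> = (\<Sum>z\<in>#Z. \<Sum>w\<in>#Z. \<integral>x. sgn (z \<bullet> x) * sgn (w \<bullet> x) \<partial>uniform_ball)"
    by (simp add: integral_sum_mset integrable_sum_mset int)
  also have "\<dots> = (\<Sum>z\<in>#Z. \<Sum>w\<in>#Z. 1 - 2 * geodesic_dist z w)"
    using Z by (intro arg_cong[of _ _ sum_mset] image_mset_cong integral_sgn_inner_mult dim) auto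
  also have "\<dots> = (real (size Z))\<^sup>2 - 2 * (\<Sum>x\<in>#Z. \<Sum>y\<in>#Z. geodesic_dist x y)"
  proof -
    have *: "(\<Sum>z\<in>#Y. f z - 2 * h z) = (\<Sum>z\<in>#Y. f z) - 2 * (\<Sum>z\<in>#Y. h z)"
      for f h :: "'a \<Rightarrow> real" and Y by (induction Y) auto
    show ?thesis by (simp add: * power2_eq_square)
  qed
  finally show ?thesis .
qed

text \<open>For the empty multiset division by zero would give mean 0 on the left but 1/2 on the
  right.\<close>

lemma mean_geodesic_dist_eq:
  fixes Z :: "'a::euclidean_space multiset"
  assumes "set_mset Z \<subseteq> sphere 0 1" "DIM('a) \<ge> 2" "Z \<noteq> {#}"
  shows "mean_geodesic_dist Z = 1 / 2 - discrepancy Z / (2 * (real (size Z))\<^sup>2)"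
  using assms by (simp add: mean_geodesic_dist_def discrepancy_eq field_simps)

subsection \<open>Signed counts and balanced distributions\<close>

lemma signed_count_minus [simp]: "signed_count Z (- x) = - signed_count Z x"
  by (induction Z) auto

lemma signed_count_image_uminus: "signed_count (image_mset uminus Z) x = - signed_count Z x"
  by (induction Z) auto

lemma signed_count_replicate_mset: "signed_count (replicate_mset n z) x = n * sgn (z \<bullet> x)"
  by (induction n) (auto simp: algebra_simps)

lemma signed_count_scaleR: "c > 0 \<Longrightarrow> signed_count Z (c *\<^sub>R x) = signed_count Z x"
  by (induction Z) (auto simp: sgn_mult)

text \<open>Off the hyperplane every point contributes 1 or -1.\<close>

lemma signed_count_parity:
  assumes "\<forall>z\<in>#Z. z \<bullet> x \<noteq> 0"
  obtains k :: int where "signed_count Z x = k" "even k \<longleftrightarrow> even (size Z)"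
proof -
  have "\<exists>k::int. signed_count Z x = k \<and> (even k \<longleftrightarrow> even (size Z))"
    using assms
  proof (induction Z)
    case empty
    then show ?case by (intro exI[of _ 0]) auto
  next
    case (add z Z)
    then obtain k :: int where k: "signed_count Z x = k" "even k \<longleftrightarrow> even (size Z)" by auto
    have "z \<bullet> x > 0 \<or> z \<bullet> x < 0" using add.prems by auto
    then show ?case
    proof
      assume "z \<bullet> x > 0"
      then show ?case using k by (intro exI[of _ "k + 1"]) auto
    next
      assume "z \<bullet> x < 0"
      then show ?case using k by (intro exI[of _ "k - 1"]) auto
    qed
  qed
  then show ?thesis using that by blast
qed

text \<open>The filter \<open>at_right 0\<close> lets the finitely many points of a multiset share
  one small \<open>e\<close>.\<close>

lemma eventually_sgn_inner_perturb:
  fixes x y z :: "'a::real_inner"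
  shows "\<forall>\<^sub>F e in at_right 0. sgn (z \<bullet> (x + e *\<^sub>R y)) = (if z \<bullet> x = 0 then sgn (z \<bullet> y) else sgn (z \<bullet> x))"
proof (cases "z \<bullet> x = 0")
  case True
  have "\<forall>\<^sub>F e in at_right 0. e > (0::real)" by (rule eventually_at_right_less)
  then show ?thesis
    by eventually_elim (simp add: True inner_add_right sgn_mult)
next
  case False
  have "((\<lambda>e. z \<bullet> (x + e *\<^sub>R y)) \<longlongrightarrow> z \<bullet> (x + 0 *\<^sub>R y)) (at_right 0)"
    by (intro tendsto_intros)
  then have lim: "((\<lambda>e. z \<bullet> (x + e *\<^sub>R y)) \<longlongrightarrow> z \<bullet> x) (at_right 0)" by simp
  from False have "z \<bullet> x > 0 \<or> z \<bullet> x < 0" by auto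
  then show ?thesis
  proof
    assume "z \<bullet> x > 0"
    with order_tendstoD(1)[OF lim this] show ?thesis
      by (auto elim!: eventually_mono)
  next
    assume "z \<bullet> x < 0"
    with order_tendstoD(2)[OF lim this] show ?thesis
      by (auto elim!: eventually_mono)
  qed
qed

lemma eventually_signed_count_perturb:
  fixes x y :: "'a::real_inner"
  shows "\<forall>\<^sub>F e in at_right 0.
    signed_count Z (x + e *\<^sub>R y) = signed_count Z x + signed_count {#z \<in># Z. z \<bullet> x = 0#} y"
proof (induction Z)
  case (add z Z)
  from add eventually_sgn_inner_perturb[of z x y] show ?case by eventually_elim auto
qed simp

lemma eventually_inner_perturb_nonzero:
  fixes x y :: "'a::real_inner"
  assumes "finite W" "\<forall>w\<in>W. w \<bullet> x = 0 \<longrightarrow> w \<bullet> y \<noteq> 0"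
  shows "\<forall>\<^sub>F e in at_right 0. \<forall>w\<in>W. w \<bullet> (x + e *\<^sub>R y) \<noteq> 0"
  using assms(1)
proof (rule eventually_ball_finite, intro ballI)
  fix w assume "w \<in> W"
  from eventually_sgn_inner_perturb[of w x y] show "\<forall>\<^sub>F e in at_right 0. w \<bullet> (x + e *\<^sub>R y) \<noteq> 0"
    by eventually_elim (use assms(2) \<open>w \<in> W\<close> in \<open>auto simp: sgn_zero_iff split: if_splits\<close>)
qed

text \<open>A subspace is not covered by finitely many proper hyperplanes in it. In the induction,
  \<open>x\<close> serves the old vectors, and adding a small multiple of \<open>y\<close> serves
  the new one without spoiling them.\<close>

lemma exists_inner_nonzero_subspace:
  fixes W :: "'a::real_inner set"
  assumes "finite W" "subspace U" "\<And>w. w \<in> W \<Longrightarrow> \<exists>y\<in>U. w \<bullet> y \<noteq> 0"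
  shows "\<exists>x\<in>U. \<forall>w\<in>W. w \<bullet> x \<noteq> 0"
  using assms(1,3)
proof (induction W)
  case empty
  then show ?case using subspace_0[OF assms(2)] by auto
next
  case (insert w W)
  then obtain x where x: "x \<in> U" "\<forall>w\<in>W. w \<bullet> x \<noteq> 0" by auto
  obtain y where y: "y \<in> U" "w \<bullet> y \<noteq> 0" using insert.prems by blast
  have "\<forall>\<^sub>F e in at_right 0. \<forall>v\<in>insert w W. v \<bullet> (x + e *\<^sub>R y) \<noteq> 0"
    using x y insert.hyps by (intro eventually_inner_perturb_nonzero) auto
  then obtain e where "\<forall>v\<in>insert w W. v \<bullet> (x + e *\<^sub>R y) \<noteq> 0"
    using eventually_happens'[OF trivial_limit_at_right_real] by blast
  then show ?case
    using x y assms(2) by (intro bexI[of _ "x + e *\<^sub>R y"]) (auto simp: subspace_add subspace_scale)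
qed

text \<open>Quantifying over all vectors, not only unit ones, lets perturbed vectors be inserted
  without normalisation.\<close>

definition balanced :: "'a::real_inner multiset \<Rightarrow> bool" where
  "balanced Z \<longleftrightarrow> (\<forall>x. (\<forall>z\<in>#Z. z \<bullet> x \<noteq> 0) \<longrightarrow> \<bar>signed_count Z x\<bar> \<le> 1)"

text \<open>Parity sharpens the bound 1 to 0 when the size is even; the \<open>of_bool\<close> term
  covers both cases at once.\<close>

lemma balanced_le_parity:
  assumes "balanced Z" and x: "\<forall>z\<in>#Z. z \<bullet> x \<noteq> 0"
  shows "\<bar>signed_count Z x\<bar> \<le> of_bool (odd (size Z))"
proof -
  from signed_count_parity[OF x] obtain k :: int
    where k: "signed_count Z x = k" "even k \<longleftrightarrow> even (size Z)" .
  have "\<bar>real_of_int k\<bar> \<le> 1" using assms k(1) unfolding balanced_def by metis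
  then have "k = 0 \<or> k = 1 \<or> k = - 1" by linarith
  then show ?thesis using k by auto
qed

text \<open>Moving off \<open>x\<close> in the directions \<open>y\<close> and \<open>- y\<close> changes the signed count by
  opposite amounts, and only the points orthogonal to \<open>x\<close> contribute.\<close>

lemma balanced_localize:
  fixes x y :: "'a::real_inner"
  assumes Z: "balanced Z" and y: "\<forall>z\<in>#Z. z \<bullet> x = 0 \<longrightarrow> z \<bullet> y \<noteq> 0"
  shows "\<bar>signed_count Z x\<bar> + \<bar>signed_count {#z \<in># Z. z \<bullet> x = 0#} y\<bar> \<le> of_bool (odd (size Z))"
proof -
  have *: "\<bar>signed_count Z x + signed_count {#z \<in># Z. z \<bullet> x = 0#} y\<bar> \<le> of_bool (odd (size Z))"
    if "\<forall>z\<in>#Z. z \<bullet> x = 0 \<longrightarrow> z \<bullet> y \<noteq> 0" for y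
  proof -
    have "\<forall>\<^sub>F e in at_right 0. \<forall>z\<in>set_mset Z. z \<bullet> (x + e *\<^sub>R y) \<noteq> 0"
      using that by (intro eventually_inner_perturb_nonzero) auto
    with eventually_signed_count_perturb[of Z x y]
    have "\<forall>\<^sub>F e::real in at_right 0. \<bar>signed_count Z x + signed_count {#z \<in># Z. z \<bullet> x = 0#} y\<bar> \<le> of_bool (odd (size Z))"
    proof eventually_elim
      case (elim e)
      then show ?case using balanced_le_parity[OF Z] by metis
    qed
    then show ?thesis by simp
  qed
  \<comment> \<open>Bounds on both \<open>|a + b|\<close> and \<open>|a - b|\<close> give the same
    bound on \<open>|a| + |b|\<close>.\<close>
  show ?thesis using *[OF y] *[of "- y"] y by simp
qed

text \<open>A generic \<open>x\<close> in the orthogonal complement of \<open>S\<close> works: each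
  \<open>w\<close> outside \<open>span S\<close> has a nonzero component in that complement, so it
  does not vanish identically there.\<close>

lemma exists_orthogonal_avoiding:
  fixes S :: "'a::euclidean_space set"
  assumes "finite W"
  obtains x where "\<And>z. z \<in> S \<Longrightarrow> z \<bullet> x = 0" "\<And>w. w \<in> W \<Longrightarrow> w \<bullet> x = 0 \<Longrightarrow> w \<in> span S"
proof -
  define U where "U = {x. \<forall>z\<in>S. z \<bullet> x = 0}"
  have "subspace U" unfolding U_def subspace_def by (auto simp: inner_add_right)
  have "\<exists>x\<in>U. \<forall>w\<in>{w\<in>W. w \<notin> span S}. w \<bullet> x \<noteq> 0"
  proof (rule exists_inner_nonzero_subspace)
    show "finite {w\<in>W. w \<notin> span S}" using assms by simp
    fix w assume w: "w \<in> {w\<in>W. w \<notin> span S}"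
    obtain a b where ab: "a \<in> span S" "\<And>v. v \<in> span S \<Longrightarrow> orthogonal b v" "w = a + b"
      by (rule orthogonal_subspace_decomp_exists[of S w]) auto
    have "b \<noteq> 0" using w ab by auto
    moreover have "a \<bullet> b = 0" using ab by (simp add: orthogonal_def inner_commute)
    ultimately have "w \<bullet> b \<noteq> 0"
      unfolding ab(3) by (simp add: inner_add_left)
    moreover have "b \<in> U"
      using ab(2) by (auto simp: U_def orthogonal_def inner_commute intro: span_base)
    ultimately show "\<exists>y\<in>U. w \<bullet> y \<noteq> 0" by blast
  qed fact
  then show ?thesis using that by (auto simp: U_def)
qed

section \<open>Multiplicities and pairs of points in balanced distributions\<close>

lemma unit_vector_in_span_singleton:
  fixes z w :: "'a::real_normed_vector"
  assumes "norm z = 1" "norm w = 1" "w \<in> span {z}"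
  shows "w = z \<or> w = - z"
proof -
  obtain c where c: "w = c *\<^sub>R z" using assms(3) by (auto simp: span_singleton)
  then have "\<bar>c\<bar> = 1" using assms by simp
  then show ?thesis using c by (auto simp: abs_if split: if_splits)
qed

text \<open>Take \<open>x\<close> orthogonal to \<open>z\<close> and to no points of
  \<open>Z\<close> other than \<open>z\<close> and \<open>- z\<close>. Localizing at
  \<open>x\<close> in the direction \<open>z\<close> then sees exactly these two
  multiplicities.\<close>

lemma balanced_antipodal:
  fixes Z :: "'a::euclidean_space multiset"
  assumes Z: "balanced Z" "set_mset Z \<subseteq> sphere 0 1" and z: "norm z = 1"
  obtains x where "\<bar>signed_count Z x\<bar> + \<bar>real (count Z z) - real (count Z (- z))\<bar> \<le> of_bool (odd (size Z))"
proof -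
  obtain x where x: "z \<bullet> x = 0" "\<And>w. w \<in># Z \<Longrightarrow> w \<bullet> x = 0 \<Longrightarrow> w \<in> span {z}"
    using exists_orthogonal_avoiding[of "set_mset Z" "{z}"] by auto
  have par: "w = z \<or> w = - z" if "w \<in># Z" "w \<bullet> x = 0" for w
    using unit_vector_in_span_singleton[OF z _ x(2)[OF that]] that Z(2) by auto
  have "z \<noteq> - z"
  proof
    assume "z = - z"
    then have "2 *\<^sub>R z = 0" by (metis add.right_inverse scaleR_2)
    then show False using z by simp
  qed
  then have "{#w \<in># Z. w \<bullet> x = 0#} = replicate_mset (count Z z) z + replicate_mset (count Z (- z)) (- z)"
    using par x(1) by (intro multiset_eqI) (auto simp: not_in_iff[symmetric])
  then have "signed_count {#w \<in># Z. w \<bullet> x = 0#} z = real (count Z z) - real (count Z (- z))"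
    using z by (simp add: signed_count_replicate_mset dot_square_norm)
  moreover have "\<forall>w\<in>#Z. w \<bullet> x = 0 \<longrightarrow> w \<bullet> z \<noteq> 0"
    using par z by (fastforce simp: dot_square_norm)
  ultimately show ?thesis using that balanced_localize[OF Z(1), of x z] by simp
qed

lemma balanced_antipodal_count:
  fixes Z :: "'a::euclidean_space multiset"
  assumes Z: "balanced Z" "set_mset Z \<subseteq> sphere 0 1"
  shows "count Z z \<le> count Z (- z) + 1"
proof (cases "norm z = 1")
  case True
  obtain x where "\<bar>signed_count Z x\<bar> + \<bar>real (count Z z) - real (count Z (- z))\<bar> \<le> of_bool (odd (size Z))"
    using balanced_antipodal[OF Z True] .
  also have "\<dots> \<le> 1" by simp
  finally show ?thesis by linarith
next
  case False
  then have "z \<notin># Z" using Z(2) by auto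
  then show ?thesis by (simp add: not_in_iff)
qed

text \<open>Otherwise some \<open>x\<close> is orthogonal to \<open>z\<close> and \<open>w\<close>
  but to no other point of \<open>Z\<close>. As \<open>w\<close> is not \<open>- z\<close>, both
  have positive inner product with \<open>z + w\<close>, so the localized count in this direction is
  2, too large for a balanced distribution.\<close>

lemma balanced_pair_third:
  fixes Z :: "'a::euclidean_space multiset"
  assumes Z: "balanced Z" "set_mset Z \<subseteq> sphere 0 1" and simple: "\<And>z. count Z z \<le> 1"
    and anti: "\<And>z. z \<in># Z \<Longrightarrow> - z \<notin># Z" and zw: "z \<in># Z" "w \<in># Z" "z \<noteq> w"
  shows "\<exists>u\<in>#Z. u \<noteq> z \<and> u \<noteq> w \<and> u \<in> span {z, w}"
proof (rule ccontr)
  assume neg: "\<not> ?thesis"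
  obtain x where x: "z \<bullet> x = 0" "w \<bullet> x = 0" "\<And>u. u \<in># Z \<Longrightarrow> u \<bullet> x = 0 \<Longrightarrow> u \<in> span {z, w}"
    using exists_orthogonal_avoiding[of "set_mset Z" "{z, w}"] by (metis finite_set_mset insertCI)
  have *: "u = z \<or> u = w" if "u \<in># Z" "u \<bullet> x = 0" for u
    using neg x(3) that by blast
  have one: "count Z z = 1" "count Z w = 1"
    using simple[of z] simple[of w] zw by (auto simp: le_Suc_eq simp flip: count_greater_zero_iff)
  have "{#u \<in># Z. u \<bullet> x = 0#} = {#z, w#}"
    using * x zw(3) one by (intro multiset_eqI) (auto simp: not_in_iff[symmetric])
  moreover have unit: "z \<bullet> z = 1" "w \<bullet> w = 1" using Z(2) zw by (auto simp: dot_square_norm)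
  have "1 + z \<bullet> w > 0"
  proof -
    have "z + w \<noteq> 0" using anti[OF zw(1)] zw(2) by (metis minus_unique)
    then have "(z + w) \<bullet> (z + w) > 0" by simp
    then show ?thesis using unit by (simp add: inner_add_left inner_add_right inner_commute)
  qed
  then have pos: "z \<bullet> (z + w) > 0" "w \<bullet> (z + w) > 0"
    using unit by (simp_all add: inner_add_right inner_commute)
  ultimately have "signed_count {#u \<in># Z. u \<bullet> x = 0#} (z + w) = 2" by simp
  moreover have "\<forall>u\<in>#Z. u \<bullet> x = 0 \<longrightarrow> u \<bullet> (z + w) \<noteq> 0" using * pos by fastforce
  moreover have "of_bool (odd (size Z)) \<le> (1::real)" by simp
  ultimately show False using balanced_localize[OF Z(1), of x "z + w"] by linarith
qed

subsection \<open>The Sylvester--Gallai theorem\<close>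

text \<open>Two of the three parameters lie weakly on the same side of \<open>f\<close>; \<rho> is
  the farther and \<sigma> the nearer of them.\<close>

lemma two_of_three_on_one_side:
  fixes f :: real
  assumes "r \<noteq> s" "s \<noteq> t" "r \<noteq> t"
  shows "\<exists>\<sigma>\<in>{r, s, t}. \<exists>\<rho>\<in>{r, s, t}. \<sigma> \<noteq> \<rho> \<and> \<bar>\<sigma> - \<rho>\<bar> \<le> \<bar>\<rho> - f\<bar>"
proof (rule ccontr)
  assume "\<not> ?thesis"
  then have "\<bar>r - s\<bar> > \<bar>r - f\<bar>" "\<bar>r - s\<bar> > \<bar>s - f\<bar>" "\<bar>s - t\<bar> > \<bar>s - f\<bar>" "\<bar>s - t\<bar> > \<bar>t - f\<bar>"
     "\<bar>r - t\<bar> > \<bar>r - f\<bar>" "\<bar>r - t\<bar> > \<bar>t - f\<bar>"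
    using assms by (auto simp: not_le abs_minus_commute)
  then show False by linarith
qed

text \<open>By Pythagoras, the squared distance from \<open>p\<close> to the line through distinct
  \<open>a\<close> and \<open>b\<close>.\<close>

definition line_dist_sq :: "'a::real_inner \<Rightarrow> 'a \<Rightarrow> 'a \<Rightarrow> real" where
  "line_dist_sq p a b = (p - a) \<bullet> (p - a) - ((p - a) \<bullet> (b - a))\<^sup>2 / ((b - a) \<bullet> (b - a))"

text \<open>Here \<open>f\<close> is the parameter of the foot of the perpendicular from
  \<open>p\<close>. With squared height \<open>h\<close> and
  \<open>n = (b - a) \<bullet> (b - a)\<close>, the new squared distance is \<open>h\<close> times a
  ratio whose numerator is at most \<open>(f - \<rho>)\<^sup>2 * n\<close> and whose denominator
  exceeds that by \<open>h\<close>.\<close>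

lemma line_dist_sq_decrease:
  fixes p a b :: "'a::real_inner"
  defines "f \<equiv> (p - a) \<bullet> (b - a) / ((b - a) \<bullet> (b - a))"
  assumes p: "p \<notin> affine hull {a, b}" and ab: "a \<noteq> b"
    and \<sigma>\<rho>: "\<sigma> \<noteq> \<rho>" "\<bar>\<sigma> - \<rho>\<bar> \<le> \<bar>\<rho> - f\<bar>"
  shows "line_dist_sq (a + \<sigma> *\<^sub>R (b - a)) (a + \<rho> *\<^sub>R (b - a)) p < line_dist_sq p a b"
proof -
  define u where "u = b - a"
  define w where "w = (p - a) - f *\<^sub>R u"
  define n where "n = u \<bullet> u"
  define h where "h = w \<bullet> w"
  have n: "n > 0" using ab by (simp add: n_def u_def)
  have pa: "p - a = w + f *\<^sub>R u" by (simp add: w_def)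
  have "w \<noteq> 0"
  proof
    assume "w = 0"
    then have "p = a + f *\<^sub>R (b - a)" using pa by (simp add: u_def algebra_simps)
    then show False using p by (auto simp: affine_hull_2_alt)
  qed
  then have h: "h > 0" by (simp add: h_def)
  have fn: "f * n = (p - a) \<bullet> u" using n by (simp add: f_def n_def u_def)
  then have wu: "w \<bullet> u = 0" by (simp add: w_def inner_diff_left n_def)
  have wu': "u \<bullet> w = 0" using wu by (simp add: inner_commute)
  have "line_dist_sq p a b = h"
  proof -
    have "(p - a) \<bullet> (p - a) = h + f\<^sup>2 * n"
      unfolding pa by (simp add: inner_add_left inner_add_right wu wu' h_def n_def power2_eq_square)
    moreover have "((p - a) \<bullet> (b - a))\<^sup>2 / ((b - a) \<bullet> (b - a)) = f\<^sup>2 * n"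
      using n fn by (simp add: u_def[symmetric] n_def[symmetric] fn[symmetric] power2_eq_square)
    ultimately show ?thesis by (simp add: line_dist_sq_def)
  qed
  moreover have "line_dist_sq (a + \<sigma> *\<^sub>R (b - a)) (a + \<rho> *\<^sub>R (b - a)) p
      = (\<sigma> - \<rho>)\<^sup>2 * n * h / (h + (f - \<rho>)\<^sup>2 * n)"
  proof -
    have 1: "(a + \<sigma> *\<^sub>R (b - a)) - (a + \<rho> *\<^sub>R (b - a)) = (\<sigma> - \<rho>) *\<^sub>R u"
      by (simp add: u_def algebra_simps)
    have 2: "p - (a + \<rho> *\<^sub>R (b - a)) = w + (f - \<rho>) *\<^sub>R u"
      by (simp add: w_def u_def algebra_simps)
    \<comment> \<open>\<open>D\<close> is the squared distance from \<open>p\<close> to the point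
      with parameter \<rho>.\<close>
    define D where "D = h + (f - \<rho>)\<^sup>2 * n"
    have "D > 0" using h n by (simp add: D_def add_pos_nonneg)
    have "(w + (f - \<rho>) *\<^sub>R u) \<bullet> (w + (f - \<rho>) *\<^sub>R u) = D"
      by (simp add: D_def inner_add_left inner_add_right wu wu' h_def n_def power2_eq_square)
    moreover have "((\<sigma> - \<rho>) *\<^sub>R u) \<bullet> (w + (f - \<rho>) *\<^sub>R u) = (\<sigma> - \<rho>) * ((f - \<rho>) * n)"
      by (simp add: inner_add_right wu' n_def)
    moreover have "((\<sigma> - \<rho>) *\<^sub>R u) \<bullet> ((\<sigma> - \<rho>) *\<^sub>R u) = (\<sigma> - \<rho>)\<^sup>2 * n"
      by (simp add: n_def power2_eq_square)
    ultimately have "line_dist_sq (a + \<sigma> *\<^sub>R (b - a)) (a + \<rho> *\<^sub>R (b - a)) p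
      = (\<sigma> - \<rho>)\<^sup>2 * n - ((\<sigma> - \<rho>) * ((f - \<rho>) * n))\<^sup>2 / D"
      unfolding line_dist_sq_def 1 2 by (simp only:)
    also have "\<dots> = (\<sigma> - \<rho>)\<^sup>2 * n * (D - (f - \<rho>)\<^sup>2 * n) / D"
      using \<open>D > 0\<close> by (simp add: field_simps power2_eq_square)
    finally show ?thesis by (simp add: D_def)
  qed
  moreover have "(\<sigma> - \<rho>)\<^sup>2 * n * h / (h + (f - \<rho>)\<^sup>2 * n) < h"
  proof -
    have "(\<sigma> - \<rho>)\<^sup>2 \<le> (f - \<rho>)\<^sup>2" using \<sigma>\<rho>(2) by (simp add: abs_le_square_iff[symmetric])
    then have "(\<sigma> - \<rho>)\<^sup>2 * n \<le> (f - \<rho>)\<^sup>2 * n" using n by simp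
    then have "(\<sigma> - \<rho>)\<^sup>2 * n < h + (f - \<rho>)\<^sup>2 * n" using h by linarith
    moreover have "h + (f - \<rho>)\<^sup>2 * n > 0" using h n by (simp add: add_pos_nonneg)
    ultimately show ?thesis using h by (simp add: divide_less_eq mult.commute)
  qed
  ultimately show ?thesis by simp
qed

text \<open>Kelly's argument: take a point and a line at minimal positive distance. Two of the three points
  on the line lie on the same side of the foot of the perpendicular, and the one nearer to the foot
  is even closer to the line through the other one and the given point.\<close>

lemma sylvester_gallai:
  fixes A :: "'a::real_inner set"
  assumes fin: "finite A"
    and third: "\<And>a b. a \<in> A \<Longrightarrow> b \<in> A \<Longrightarrow> a \<noteq> b \<Longrightarrow> \<exists>c\<in>A. c \<noteq> a \<and> c \<noteq> b \<and> c \<in> affine hull {a, b}"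
    and ab: "a \<in> A" "b \<in> A" "a \<noteq> b"
  shows "A \<subseteq> affine hull {a, b}"
proof (rule ccontr)
  define T where "T = {(p, a, b). p \<in> A \<and> a \<in> A \<and> b \<in> A \<and> a \<noteq> b \<and> p \<notin> affine hull {a, b}}"
  define dist3 where "dist3 = (\<lambda>(p, a, b). line_dist_sq p a (b :: 'a))"
  assume "\<not> A \<subseteq> affine hull {a, b}"
  then have "T \<noteq> {}" using ab by (auto simp: T_def)
  moreover have "finite T"
    by (rule finite_subset[of _ "A \<times> A \<times> A"]) (auto simp: T_def fin)
  ultimately obtain t where t: "is_arg_min dist3 (\<lambda>t. t \<in> T) t"
    using ex_is_arg_min_if_finite by blast
  obtain p a b where "t = (p, a, b)" by (cases t)
  then have T: "(p, a, b) \<in> T" and min: "\<And>q c d. (q, c, d) \<in> T \<Longrightarrow> line_dist_sq p a b \<le> line_dist_sq q c d"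
    using t by (force simp: is_arg_min_linorder dist3_def)+
  then have pab: "p \<in> A" "a \<in> A" "b \<in> A" "a \<noteq> b" "p \<notin> affine hull {a, b}" by (auto simp: T_def)
  obtain c where c: "c \<in> A" "c \<noteq> a" "c \<noteq> b" "c \<in> affine hull {a, b}"
    using third[OF pab(2-4)] by blast
  then obtain \<tau> where \<tau>: "c = a + \<tau> *\<^sub>R (b - a)" by (auto simp: affine_hull_2_alt)
  define P where "P = (\<lambda>r::real. a + r *\<^sub>R (b - a))"
  have "\<tau> \<noteq> 0" "\<tau> \<noteq> 1" using c \<tau> by auto
  \<comment> \<open>On the line, \<open>a\<close>, \<open>b\<close> and \<open>c\<close> have the
    parameters 0, 1 and \<tau>; the last argument is the parameter of the foot of the perpendicular
    from \<open>p\<close>.\<close>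
  from two_of_three_on_one_side[of 0 1 \<tau> "(p - a) \<bullet> (b - a) / ((b - a) \<bullet> (b - a))"] this
  obtain \<sigma> \<rho> where \<sigma>\<rho>: "\<sigma> \<in> {0, 1, \<tau>}" "\<rho> \<in> {0, 1, \<tau>}" "\<sigma> \<noteq> \<rho>"
    "\<bar>\<sigma> - \<rho>\<bar> \<le> \<bar>\<rho> - (p - a) \<bullet> (b - a) / ((b - a) \<bullet> (b - a))\<bar>"
    by (metis zero_neq_one)
  have PA: "P \<sigma> \<in> A" "P \<rho> \<in> A" using \<sigma>\<rho>(1,2) pab c \<tau> by (auto simp: P_def)
  have Pline: "P r \<in> affine hull {a, b}" for r by (auto simp: P_def affine_hull_2_alt)
  have P_ne: "P \<sigma> \<noteq> P \<rho>" using \<sigma>\<rho>(3) pab(4) by (simp add: P_def)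
  have "P \<rho> \<noteq> p" using Pline pab(5) by metis
  moreover have "P \<sigma> \<notin> affine hull {P \<rho>, p}"
  proof
    assume "P \<sigma> \<in> affine hull {P \<rho>, p}"
    then obtain s where s: "P \<sigma> = P \<rho> + s *\<^sub>R (p - P \<rho>)" by (auto simp: affine_hull_2_alt)
    then have "s \<noteq> 0" using P_ne by auto
    have "s *\<^sub>R (p - P \<rho>) = (\<sigma> - \<rho>) *\<^sub>R (b - a)"
      using s by (simp add: P_def algebra_simps)
    then have "p - P \<rho> = ((\<sigma> - \<rho>) / s) *\<^sub>R (b - a)"
      using \<open>s \<noteq> 0\<close> by (metis (no_types) divide_inverse_commute scaleR_scaleR left_inverse scaleR_one)
    then have "p = P (\<rho> + (\<sigma> - \<rho>) / s)" by (simp add: P_def algebra_simps)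
    then show False using Pline pab(5) by metis
  qed
  ultimately have "(P \<sigma>, P \<rho>, p) \<in> T" using PA pab by (simp add: T_def)
  from min[OF this] line_dist_sq_decrease[OF pab(5,4) \<sigma>\<rho>(3,4)] show False by (simp add: P_def)
qed

section \<open>From collinear points to great circles\<close>

lemma dim_span_unit_pair:
  fixes z w :: "'a::euclidean_space"
  assumes "norm z = 1" "norm w = 1" "z \<noteq> w" "z \<noteq> - w"
  shows "dim (span {z, w}) = 2"
proof -
  have "w \<noteq> 0" using assms by auto
  have "z \<notin> span {w}" using unit_vector_in_span_singleton[of w z] assms by auto
  then have "independent {z, w}" using \<open>w \<noteq> 0\<close> \<open>z \<noteq> w\<close> by (simp add: independent_insert)
  then show ?thesis using assms(3) by (simp add: dim_eq_card_independent)
qed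

text \<open>In an affine chart the hypothesis on spans becomes that of
  \<open>sylvester_gallai\<close>, and the resulting line spans the plane sought. With at most one
  point, any plane through it serves.\<close>

lemma third_point_imp_great_circle:
  fixes S :: "'a::euclidean_space set"
  assumes fin: "finite S" and S: "S \<subseteq> sphere 0 1" and dim: "DIM('a) \<ge> 2"
    and anti: "\<And>z. z \<in> S \<Longrightarrow> - z \<notin> S"
    and third: "\<And>z w. z \<in> S \<Longrightarrow> w \<in> S \<Longrightarrow> z \<noteq> w \<Longrightarrow> \<exists>u\<in>S. u \<noteq> z \<and> u \<noteq> w \<and> u \<in> span {z, w}"
  shows "\<exists>V. subspace V \<and> dim V = 2 \<and> S \<subseteq> V"
proof (cases "\<exists>z\<in>S. \<exists>w\<in>S. z \<noteq> w")
  case True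
  then obtain z w where zw: "z \<in> S" "w \<in> S" "z \<noteq> w" by blast
  \<comment> \<open>The chart has to be defined on all of \<open>S\<close>, so \<open>v\<close> must
    be orthogonal to none of its points.\<close>
  have "\<exists>v\<in>UNIV. \<forall>z\<in>S. z \<bullet> v \<noteq> 0"
  proof (rule exists_inner_nonzero_subspace[OF fin])
    fix z assume "z \<in> S"
    then have "z \<bullet> z \<noteq> 0" using S by auto
    then show "\<exists>y\<in>UNIV. z \<bullet> y \<noteq> 0" by blast
  qed simp
  then obtain v where v: "\<And>z. z \<in> S \<Longrightarrow> z \<bullet> v \<noteq> 0" by blast
  \<comment> \<open>The central projection to the affine hyperplane \<open>y \<bullet> v = 1\<close> turns great circles into lines.\<close>
  define q where "q = (\<lambda>z. (1 / (z \<bullet> v)) *\<^sub>R z)"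
  \<comment> \<open>Central projection identifies only antipodes, and these are excluded by
    \<open>anti\<close>.\<close>
  have q_inj: "z = u" if "z \<in> S" "u \<in> S" "q z = q u" for z u
  proof -
    have "z = (z \<bullet> v) *\<^sub>R q z" using v[OF that(1)] by (simp add: q_def)
    also have "\<dots> = ((z \<bullet> v) / (u \<bullet> v)) *\<^sub>R u" unfolding that(3) by (simp add: q_def)
    finally have "z \<in> span {u}" by (metis span_base span_scale singletonI)
    moreover have "norm u = 1" "norm z = 1" using that S by auto
    ultimately have "z = u \<or> z = - u" using unit_vector_in_span_singleton[of u z] by blast
    then show ?thesis using anti that(1,2) by auto
  qed
  have q_span: "q u \<in> affine hull {q z, q w}"
    if S: "z \<in> S" "w \<in> S" "u \<in> S" and u_span: "u \<in> span {z, w}" for z w u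
  proof -
    obtain \<alpha> \<beta> where u: "u = \<alpha> *\<^sub>R z + \<beta> *\<^sub>R w"
      using u_span by (auto simp: span_insert span_singleton algebra_simps)
    have uv: "u \<bullet> v = \<alpha> * (z \<bullet> v) + \<beta> * (w \<bullet> v)" by (simp add: u inner_add_left)
    \<comment> \<open>Rescaling turns the linear combination into an affine one: \<open>q u\<close>,
      \<open>q z\<close> and \<open>q w\<close> all have inner product 1 with \<open>v\<close>, so
      the new coefficients sum to 1.\<close>
    have "q u = (\<alpha> * (z \<bullet> v) / (u \<bullet> v)) *\<^sub>R q z + (\<beta> * (w \<bullet> v) / (u \<bullet> v)) *\<^sub>R q w"
      using v S by (simp add: q_def u scaleR_add_right)
    moreover have "\<alpha> * (z \<bullet> v) / (u \<bullet> v) + \<beta> * (w \<bullet> v) / (u \<bullet> v) = 1"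
      using v[OF S(3)] by (simp add: uv add_divide_distrib[symmetric])
    ultimately show ?thesis unfolding affine_hull_2 by blast
  qed
  have "q ` S \<subseteq> affine hull {q z, q w}"
  proof (rule sylvester_gallai)
    show "finite (q ` S)" using fin by simp
    show "q z \<in> q ` S" "q w \<in> q ` S" "q z \<noteq> q w" using zw q_inj by auto
    fix a b assume "a \<in> q ` S" "b \<in> q ` S" "a \<noteq> b"
    then obtain z w where zw: "z \<in> S" "w \<in> S" "a = q z" "b = q w" "z \<noteq> w" by blast
    then obtain u where "u \<in> S" "u \<noteq> z" "u \<noteq> w" "u \<in> span {z, w}" using third by blast
    then show "\<exists>c\<in>q ` S. c \<noteq> a \<and> c \<noteq> b \<and> c \<in> affine hull {a, b}"
      using zw q_inj q_span by blast
  qed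
  moreover have "affine hull {q z, q w} \<subseteq> span {z, w}"
  proof -
    have "{q z, q w} \<subseteq> span {z, w}" unfolding q_def by (simp add: span_scale span_base)
    then have "span {q z, q w} \<subseteq> span {z, w}" by (simp add: span_minimal)
    then show ?thesis using affine_hull_subset_span by blast
  qed
  ultimately have q_in: "q ` S \<subseteq> span {z, w}" by blast
  have "u \<in> span {z, w}" if "u \<in> S" for u
  proof -
    have "u = (u \<bullet> v) *\<^sub>R q u" using v[OF that] by (simp add: q_def)
    then show ?thesis using q_in that by (metis imageI span_scale subsetD)
  qed
  moreover have "dim (span {z, w}) = 2"
    using zw S anti by (intro dim_span_unit_pair) auto
  ultimately show ?thesis by (intro exI[of _ "span {z, w}"]) auto
next
  case False
  \<comment> \<open>If \<open>S\<close> is empty, an arbitrary basis vector stands in for its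
    point.\<close>
  obtain z where z: "norm z = 1" "S \<subseteq> {z}"
  proof (cases "S = {}")
    case True
    then show ?thesis using that[of "SOME b. b \<in> Basis"] by (simp add: some_in_eq)
  next
    case False
    then show ?thesis using that S \<open>\<not> (\<exists>z\<in>S. \<exists>w\<in>S. z \<noteq> w)\<close> by fastforce
  qed
  obtain e where e: "e \<noteq> 0" "orthogonal z e" using orthogonal_to_vector_exists[OF dim] by blast
  define e' where "e' = e /\<^sub>R norm e"
  have e': "norm e' = 1" "z \<bullet> e' = 0" using e by (auto simp: e'_def orthogonal_def)
  then have "z \<noteq> e'" "z \<noteq> - e'" using z by (auto simp: dot_square_norm)
  then have "dim (span {z, e'}) = 2" using z e' by (intro dim_span_unit_pair) auto
  then show ?thesis using z(2) by (intro exI[of _ "span {z, e'}"]) (auto intro: span_base)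
qed

subsection \<open>Minimal discrepancy\<close>

lemma AE_uniform_ball_generic:
  fixes Z :: "'a::euclidean_space multiset"
  assumes "set_mset Z \<subseteq> sphere 0 1"
  shows "AE x in uniform_ball. \<forall>z\<in>#Z. z \<bullet> x \<noteq> 0"
proof (rule AE_finite_allI)
  fix z assume "z \<in># Z"
  then have "z \<noteq> 0" using assms by auto
  then show "AE x in uniform_ball. z \<bullet> x \<noteq> 0" by (rule AE_uniform_ball_inner_nonzero)
qed simp

text \<open>An odd integer is nonzero, so its square is at least 1.\<close>

lemma parity_le_signed_count_sq:
  assumes "\<forall>z\<in>#Z. z \<bullet> x \<noteq> 0"
  shows "of_bool (odd (size Z)) \<le> (signed_count Z x)\<^sup>2"
proof -
  from signed_count_parity[OF assms] obtain k :: int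
    where k: "signed_count Z x = k" "even k \<longleftrightarrow> even (size Z)" .
  have "1 \<le> k\<^sup>2" if "odd k"
    using that by (smt (verit, best) even_zero power2_less_eq_zero_iff)
  then have "1 \<le> (real_of_int k)\<^sup>2" if "odd k"
    using that by (metis of_int_1_le_iff of_int_power)
  then show ?thesis using k by auto
qed

lemma discrepancy_ge:
  fixes Z :: "'a::euclidean_space multiset"
  assumes "set_mset Z \<subseteq> sphere 0 1"
  shows "of_bool (odd (size Z)) \<le> discrepancy Z"
proof -
  have "(\<integral>x. of_bool (odd (size Z)) \<partial>(uniform_ball :: 'a measure)) \<le> discrepancy Z"
    unfolding discrepancy_def
  proof (intro integral_mono_AE integrable_signed_count_sq)
    show "AE x in uniform_ball. of_bool (odd (size Z)) \<le> (signed_count Z x)\<^sup>2"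
      using AE_uniform_ball_generic[OF assms] by eventually_elim (rule parity_le_signed_count_sq)
  qed simp
  then show ?thesis by simp
qed

lemma balanced_imp_discrepancy:
  fixes Z :: "'a::euclidean_space multiset"
  assumes Z: "set_mset Z \<subseteq> sphere 0 1" and "balanced Z"
  shows "discrepancy Z = of_bool (odd (size Z))"
proof -
  have "discrepancy Z = (\<integral>x. of_bool (odd (size Z)) \<partial>(uniform_ball :: 'a measure))"
    unfolding discrepancy_def
  proof (rule integral_cong_AE)
    show "AE x in uniform_ball. (signed_count Z x)\<^sup>2 = of_bool (odd (size Z))"
      using AE_uniform_ball_generic[OF Z]
    proof eventually_elim
      case (elim x)
      have "\<bar>signed_count Z x\<bar>\<^sup>2 \<le> (of_bool (odd (size Z)))\<^sup>2"
        using balanced_le_parity[OF \<open>balanced Z\<close> elim] by (rule power_mono) simp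
      then show ?case using parity_le_signed_count_sq[OF elim] by (auto simp: of_bool_def split: if_splits)
    qed
  qed measurable
  then show ?thesis by simp
qed

text \<open>Nonempty open sets have positive measure, and \<open>norm y < 1\<close> ensures that
  \<open>U\<close> meets the unit ball.\<close>

lemma AE_uniform_ball_open:
  fixes U :: "'a::euclidean_space set"
  assumes "AE x in uniform_ball. P x" "open U" "y \<in> U" "norm y < 1"
  obtains x where "x \<in> U" "P x"
proof (rule ccontr)
  assume neg: "\<not> thesis"
  define V where "V = U \<inter> ball 0 1"
  have V: "open V" "V \<noteq> {}" using assms(2-4) by (auto simp: V_def)
  have "AE x in lborel. x \<notin> V"
    using assms(1) unfolding AE_uniform_ball_iff
    by eventually_elim (use neg that in \<open>auto simp: V_def\<close>)
  moreover have "V \<in> sets lborel" using V by simp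
  ultimately have "V \<in> null_sets lborel" by (simp add: AE_iff_null_sets)
  then have "negligible V" by (simp add: negligible_iff_null_sets null_sets_completionI)
  then show False using open_not_negligible V by blast
qed

text \<open>Equality forces the squared count to equal its lower bound almost everywhere. The count
  is locally constant at generic vectors, so this extends from almost all of them to every
  one.\<close>

lemma discrepancy_imp_balanced:
  fixes Z :: "'a::euclidean_space multiset"
  assumes Z: "set_mset Z \<subseteq> sphere 0 1" and eq: "discrepancy Z = of_bool (odd (size Z))"
  shows "balanced Z"
  unfolding balanced_def
proof (intro allI impI)
  fix x assume x: "\<forall>z\<in>#Z. z \<bullet> x \<noteq> 0"
  define p :: real where "p = of_bool (odd (size Z))"
  have "(\<integral>x. (signed_count Z x)\<^sup>2 - p \<partial>uniform_ball) = 0"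
    using eq
    by (subst Bochner_Integration.integral_diff)
       (auto intro: integrable_signed_count_sq simp: p_def discrepancy_def)
  moreover have "AE x in uniform_ball. (signed_count Z x)\<^sup>2 - p \<ge> 0"
    using AE_uniform_ball_generic[OF Z]
    by eventually_elim (simp add: p_def parity_le_signed_count_sq)
  ultimately have AE: "AE x in uniform_ball. (signed_count Z x)\<^sup>2 - p = 0"
    by (subst (asm) integral_nonneg_eq_0_iff_AE) (auto intro: integrable_signed_count_sq)
  \<comment> \<open>\<open>U\<close> is the open cone of vectors with the same signs as
    \<open>x\<close> at all points of \<open>Z\<close>; \<open>y\<close> is a copy of
    \<open>x\<close> shrunk into the unit ball.\<close>
  define U where "U = (\<Inter>z\<in>set_mset Z. {y. 0 < (z \<bullet> x) * (z \<bullet> y)})"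
  define y where "y = (1 / (1 + norm x)) *\<^sub>R x"
  have c: "1 / (1 + norm x) > 0" by (simp add: add_pos_nonneg)
  have "open U"
    unfolding U_def by (intro open_INT open_Collect_less continuous_intros ballI) auto
  moreover have "y \<in> U"
    unfolding U_def
  proof (intro INT_I CollectI)
    fix z assume "z \<in># Z"
    then have "0 < (z \<bullet> x)\<^sup>2 * (1 / (1 + norm x))" using x c by (intro mult_pos_pos) auto
    then show "0 < (z \<bullet> x) * (z \<bullet> y)" by (simp add: y_def power2_eq_square)
  qed
  moreover have "norm y < 1" by (simp add: y_def add_pos_nonneg)
  ultimately obtain w where w: "w \<in> U" "(signed_count Z w)\<^sup>2 - p = 0"
    using AE_uniform_ball_open[OF AE] by blast
  have "sgn (z \<bullet> w) = sgn (z \<bullet> x)" if "z \<in># Z" for z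
    using w(1) that by (auto simp: U_def zero_less_mult_iff)
  then have "signed_count Z w = signed_count Z x"
    unfolding signed_count_def by (intro arg_cong[of _ _ sum_mset] image_mset_cong) auto
  with w(2) have "(signed_count Z x)\<^sup>2 \<le> 1" by (simp add: p_def of_bool_def split: if_splits)
  then show "\<bar>signed_count Z x\<bar> \<le> 1" by (simp add: abs_square_le_1)
qed

lemma discrepancy_eq_parity_iff:
  "set_mset Z \<subseteq> sphere 0 1 \<Longrightarrow> discrepancy Z = of_bool (odd (size Z)) \<longleftrightarrow> balanced Z"
  using balanced_imp_discrepancy discrepancy_imp_balanced by blast

lemma discrepancy_cong:
  "(\<And>x. signed_count Y x = signed_count Z x) \<Longrightarrow> discrepancy Y = discrepancy Z"
  by (simp add: discrepancy_def)

text \<open>Antipodal pairs at \<open>b\<close> and \<open>- b\<close>, with one further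
  \<open>b\<close> when \<open>N\<close> is odd.\<close>

lemma exists_balanced_distribution:
  obtains Z :: "'a::euclidean_space multiset" where "Z \<in> point_distributions N" "balanced Z"
proof -
  obtain b :: 'a where b: "b \<in> Basis" using nonempty_Basis by blast
  define Z where "Z = replicate_mset (N div 2) b + replicate_mset (N div 2) (- b) + replicate_mset (N mod 2) b"
  have "size Z = N" unfolding Z_def by simp presburger
  moreover have "set_mset Z \<subseteq> sphere 0 1" using b by (auto simp: Z_def)
  moreover have "balanced Z"
  proof -
    have "N mod 2 = 0 \<or> N mod 2 = 1" by auto
    then show ?thesis
      unfolding balanced_def Z_def by (auto simp: signed_count_replicate_mset abs_sgn_le_1)
  qed
  ultimately show ?thesis using that by (simp add: point_distributions_def)
qed

section \<open>The maximal mean distance and the hemisphere criterion\<close>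

lemma mean_geodesic_dist_le:
  fixes Z :: "'a::euclidean_space multiset"
  assumes Z: "Z \<in> point_distributions N" and N: "N \<ge> 1" and dim: "DIM('a) \<ge> 2"
  shows "mean_geodesic_dist Z \<le> 1 / 2 - of_bool (odd N) / (2 * (real N)\<^sup>2)"
    and "mean_geodesic_dist Z = 1 / 2 - of_bool (odd N) / (2 * (real N)\<^sup>2) \<longleftrightarrow> balanced Z"
proof -
  have Z': "set_mset Z \<subseteq> sphere 0 1" "size Z = N" using Z by (auto simp: point_distributions_def)
  then have eq: "mean_geodesic_dist Z = 1 / 2 - discrepancy Z / (2 * (real N)\<^sup>2)"
    using mean_geodesic_dist_eq[OF Z'(1) dim] N by force
  show "mean_geodesic_dist Z \<le> 1 / 2 - of_bool (odd N) / (2 * (real N)\<^sup>2)"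
    unfolding eq using discrepancy_ge[OF Z'(1)] Z'(2) by (simp add: divide_right_mono)
  show "mean_geodesic_dist Z = 1 / 2 - of_bool (odd N) / (2 * (real N)\<^sup>2) \<longleftrightarrow> balanced Z"
    unfolding eq using discrepancy_eq_parity_iff[OF Z'(1)] Z'(2) N by auto
qed

text \<open>A balanced distribution exists, so the upper bound is attained and the maximizers are
  exactly its equality cases.\<close>

lemma is_maximizer_iff_balanced:
  fixes Z :: "'a::euclidean_space multiset"
  assumes Z: "Z \<in> point_distributions N" and N: "N \<ge> 1" and dim: "DIM('a) \<ge> 2"
  shows "is_maximizer N Z \<longleftrightarrow> balanced Z"
proof -
  obtain Y :: "'a multiset" where "Y \<in> point_distributions N" "balanced Y"
    by (rule exists_balanced_distribution)
  then show ?thesis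
    using mean_geodesic_dist_le[OF _ N dim] Z unfolding is_arg_max_def
    by (metis less_le_not_le order_antisym_conv not_le)
qed

lemma is_maximum_mean_geodesic_dist:
  assumes N: "N \<ge> 1" and dim: "DIM('a::euclidean_space) \<ge> 2"
  shows "is_maximum (mean_geodesic_dist ` (point_distributions N :: 'a multiset set))
    (1 / 2 - of_bool (odd N) / (2 * (real N)\<^sup>2))"
proof -
  obtain Y :: "'a multiset" where "Y \<in> point_distributions N" "balanced Y"
    by (rule exists_balanced_distribution)
  then show ?thesis
    using mean_geodesic_dist_le[OF _ N dim] by (force simp: is_maximum_def image_iff)
qed

lemma hemisphere_count_difference:
  assumes "set_mset Z \<subseteq> sphere 0 1"
  shows "real_of_int (int (size {#z \<in># Z. z \<in> open_hemisphere x#})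
    - int (size {#z \<in># Z. z \<in> open_hemisphere (- x)#})) = signed_count Z x"
  using assms by (induction Z) (auto simp: open_hemisphere_def sgn_real_def)

lemma balanced_iff_hemispheres:
  fixes Z :: "'a::euclidean_space multiset"
  assumes Z: "set_mset Z \<subseteq> sphere 0 1"
  shows "balanced Z \<longleftrightarrow> (\<forall>x \<in> sphere 0 1. set_mset Z \<inter> perp_hyperplane x = {} \<longrightarrow>
           \<bar>int (size {#z \<in># Z. z \<in> open_hemisphere x#})
            - int (size {#z \<in># Z. z \<in> open_hemisphere (- x)#})\<bar> \<le> 1)"
proof -
  have generic: "set_mset Z \<inter> perp_hyperplane x = {} \<longleftrightarrow> (\<forall>z\<in>#Z. z \<bullet> x \<noteq> 0)" for x
    by (auto simp: perp_hyperplane_def)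
  have count: "\<bar>int (size {#z \<in># Z. z \<in> open_hemisphere x#})
            - int (size {#z \<in># Z. z \<in> open_hemisphere (- x)#})\<bar> \<le> 1 \<longleftrightarrow> \<bar>signed_count Z x\<bar> \<le> 1" for x
    unfolding hemisphere_count_difference[OF Z, of x, symmetric] by linarith
  have "\<bar>signed_count Z x\<bar> \<le> 1"
    if *: "\<forall>x\<in>sphere 0 1. (\<forall>z\<in>#Z. z \<bullet> x \<noteq> 0) \<longrightarrow> \<bar>signed_count Z x\<bar> \<le> 1"
      and x: "\<forall>z\<in>#Z. z \<bullet> x \<noteq> 0" for x
  proof (cases "x = 0")
    case True
    \<comment> \<open>Every point is orthogonal to 0, so 0 is generic only for the empty
      multiset.\<close>
    then have "Z = {#}" using x by (cases Z) auto
    then show ?thesis by simp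
  next
    case False
    then have "\<bar>signed_count Z ((1 / norm x) *\<^sub>R x)\<bar> \<le> 1"
      using x by (intro *[rule_format]) auto
    then show ?thesis using False signed_count_scaleR[of "1 / norm x" Z x] by simp
  qed
  then show ?thesis unfolding generic count balanced_def by blast
qed

subsection \<open>Structure of the maximizers\<close>

lemma count_image_mset_uminus:
  fixes Z :: "'a::group_add multiset"
  shows "count (image_mset uminus Z) z = count Z (- z)"
  by (induction Z) auto

text \<open>Off the sphere both counts are 0, so the condition extends to all vectors.\<close>

lemma centrally_symmetric_iff:
  assumes "set_mset Z \<subseteq> sphere 0 1"
  shows "centrally_symmetric Z \<longleftrightarrow> image_mset uminus Z = Z"
proof -
  have "count Z x = count Z (- x)" if "x \<notin> sphere 0 1" for x
  proof -
    have "x \<notin># Z" "- x \<notin># Z" using assms that by auto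
    then show ?thesis by (simp add: not_in_iff)
  qed
  then show ?thesis
    unfolding centrally_symmetric_def multiset_eq_iff count_image_mset_uminus by metis
qed

lemma signed_count_symmetric:
  assumes "image_mset uminus Z = Z"
  shows "signed_count Z x = 0"
  using signed_count_image_uminus[of Z x] assms by simp

text \<open>The signed count vanishes, while at a generic vector it has the parity of the
  size.\<close>

lemma even_size_symmetric:
  fixes Z :: "'a::euclidean_space multiset"
  assumes "set_mset Z \<subseteq> sphere 0 1" "image_mset uminus Z = Z"
  shows "even (size Z)"
proof -
  have "\<exists>x\<in>UNIV. \<forall>z\<in>set_mset Z. z \<bullet> x \<noteq> 0"
  proof (rule exists_inner_nonzero_subspace)
    fix z assume "z \<in># Z"
    then have "z \<bullet> z \<noteq> 0" using assms(1) by auto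
    then show "\<exists>y\<in>UNIV. z \<bullet> y \<noteq> 0" by blast
  qed auto
  then obtain x where "\<forall>z\<in>#Z. z \<bullet> x \<noteq> 0" by blast
  from parity_le_signed_count_sq[OF this] show ?thesis
    by (auto simp: signed_count_symmetric[OF assms(2)] of_bool_def split: if_splits)
qed

text \<open>For even size the bound in \<open>balanced_antipodal\<close> is 0, so antipodal
  multiplicities agree. Conversely, symmetry cancels the signed count.\<close>

lemma balanced_even_iff_symmetric:
  fixes Z :: "'a::euclidean_space multiset"
  assumes Z: "set_mset Z \<subseteq> sphere 0 1" and even: "even (size Z)"
  shows "balanced Z \<longleftrightarrow> centrally_symmetric Z"
proof
  assume bal: "balanced Z"
  show "centrally_symmetric Z"
    unfolding centrally_symmetric_def
  proof
    fix z :: 'a assume "z \<in> sphere 0 1"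
    then have "norm z = 1" by simp
    from balanced_antipodal[OF bal Z this] obtain x
      where "\<bar>signed_count Z x\<bar> + \<bar>real (count Z z) - real (count Z (- z))\<bar> \<le> of_bool (odd (size Z))" .
    then show "count Z z = count Z (- z)" using even by simp
  qed
next
  assume "centrally_symmetric Z"
  then have "image_mset uminus Z = Z" using centrally_symmetric_iff[OF Z] by simp
  then show "balanced Z" by (simp add: balanced_def signed_count_symmetric)
qed

text \<open>Removing a centrally symmetric part does not change the signed count, so
  \<open>Z\<close> is balanced exactly when \<open>Z2\<close> is. For a balanced \<open>Z\<close>,
  cancelling all antipodal pairs leaves simple points without antipodes, to which
  \<open>balanced_pair_third\<close> and the great circle lemma apply.\<close>

lemma balanced_odd_iff_decomposition:
  fixes Z :: "'a::euclidean_space multiset"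
  assumes Z: "set_mset Z \<subseteq> sphere 0 1" and odd: "odd (size Z)" and dim: "DIM('a) \<ge> 2"
  shows "balanced Z \<longleftrightarrow> (\<exists>Z1 Z2. Z = Z1 + Z2 \<and> centrally_symmetric Z1
              \<and> (\<exists>V. subspace V \<and> dim V = 2 \<and> set_mset Z2 \<subseteq> V)
              \<and> mean_geodesic_dist Z2 = 1 / 2 - 1 / (2 * (real (size Z2))\<^sup>2))"
proof -
  have key: "balanced Z2 \<longleftrightarrow> balanced Z"
    "balanced Z2 \<longleftrightarrow> mean_geodesic_dist Z2 = 1 / 2 - 1 / (2 * (real (size Z2))\<^sup>2)"
    if sum: "Z = Z1 + Z2" and sym: "image_mset uminus Z1 = Z1" for Z1 Z2
  proof -
    have sub: "set_mset Z1 \<subseteq> sphere 0 1" "set_mset Z2 \<subseteq> sphere 0 1" using Z sum by auto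
    \<comment> \<open>Odd size excludes the empty \<open>Z2\<close> and gives \<open>Z2\<close> the
      same parity bound as \<open>Z\<close>.\<close>
    have odd2: "odd (size Z2)" using odd even_size_symmetric[OF sub(1) sym] sum by simp
    have "discrepancy Z = discrepancy Z2"
      using sum sym by (intro discrepancy_cong) (simp add: signed_count_symmetric)
    then show "balanced Z2 \<longleftrightarrow> balanced Z"
      using discrepancy_eq_parity_iff[OF Z] discrepancy_eq_parity_iff[OF sub(2)] odd odd2 by simp
    show "balanced Z2 \<longleftrightarrow> mean_geodesic_dist Z2 = 1 / 2 - 1 / (2 * (real (size Z2))\<^sup>2)"
      using mean_geodesic_dist_le(2)[of Z2 "size Z2"] sub(2) odd2 dim
      by (auto simp: point_distributions_def Suc_le_eq odd_pos)
  qed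
  show ?thesis
  proof
    assume bal: "balanced Z"
    \<comment> \<open>\<open>Z1\<close> takes the smaller of the multiplicities of \<open>z\<close>
      and \<open>- z\<close>, and \<open>Z2\<close> keeps the excess.\<close>
    define Z1 where "Z1 = Z \<inter># image_mset uminus Z"
    define Z2 where "Z2 = Z - image_mset uminus Z"
    have sum: "Z = Z1 + Z2" by (auto simp: Z1_def Z2_def multiset_eq_iff)
    have sym: "image_mset uminus Z1 = Z1"
      by (simp add: Z1_def multiset_eq_iff count_image_mset_uminus min.commute)
    have sub: "set_mset Z1 \<subseteq> sphere 0 1" "set_mset Z2 \<subseteq> sphere 0 1"
      using Z by (simp_all add: sum)
    have bal2: "balanced Z2" using key(1)[OF sum sym] bal by simp
    have count2: "count Z2 z = count Z z - count Z (- z)" for z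
      by (simp add: Z2_def count_image_mset_uminus)
    have simple: "count Z2 z \<le> 1" for z
      using balanced_antipodal_count[OF bal Z, of z] by (simp add: count2)
    have anti: "- z \<notin># Z2" if "z \<in># Z2" for z
      using that by (simp add: count2 not_in_iff flip: count_greater_zero_iff)
    have "\<exists>V. subspace V \<and> dim V = 2 \<and> set_mset Z2 \<subseteq> V"
      using balanced_pair_third[OF bal2 sub(2) simple anti]
      by (intro third_point_imp_great_circle sub dim anti) auto
    then show "\<exists>Z1 Z2. Z = Z1 + Z2 \<and> centrally_symmetric Z1
              \<and> (\<exists>V. subspace V \<and> dim V = 2 \<and> set_mset Z2 \<subseteq> V)
              \<and> mean_geodesic_dist Z2 = 1 / 2 - 1 / (2 * (real (size Z2))\<^sup>2)"
      using sum key(2)[OF sum sym] bal2 sym centrally_symmetric_iff[OF sub(1)] by blast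
  next
    assume "\<exists>Z1 Z2. Z = Z1 + Z2 \<and> centrally_symmetric Z1
              \<and> (\<exists>V. subspace V \<and> dim V = 2 \<and> set_mset Z2 \<subseteq> V)
              \<and> mean_geodesic_dist Z2 = 1 / 2 - 1 / (2 * (real (size Z2))\<^sup>2)"
    then obtain Z1 Z2 where *: "Z = Z1 + Z2" "centrally_symmetric Z1"
      "mean_geodesic_dist Z2 = 1 / 2 - 1 / (2 * (real (size Z2))\<^sup>2)" by blast
    have "set_mset Z1 \<subseteq> sphere 0 1" using Z *(1) by auto
    then have "image_mset uminus Z1 = Z1" using *(2) centrally_symmetric_iff by blast
    from key[OF *(1) this] show "balanced Z" using *(3) by simp
  qed
qed

theorem theorem3p5:
  fixes d :: nat
  assumes "d \<ge> 1" and "CARD('n::finite) = d + 1"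
  shows
    "(\<forall>N\<ge>1. \<forall>Z \<in> point_distributions N :: (real ^ 'n) multiset set.
        mean_geodesic_dist Z \<le> 1 / 2)
   \<and> (\<forall>N\<ge>1. \<forall>Z \<in> point_distributions N :: (real ^ 'n) multiset set.
        is_maximizer N Z \<longleftrightarrow>
        (\<forall>x \<in> sphere 0 1. set_mset Z \<inter> perp_hyperplane x = {} \<longrightarrow>
           \<bar>int (size {#z \<in># Z. z \<in> open_hemisphere x#})
            - int (size {#z \<in># Z. z \<in> open_hemisphere (- x)#})\<bar> \<le> 1))
   \<and> (\<forall>N\<ge>1. even N \<longrightarrow>
        is_maximum (mean_geodesic_dist ` (point_distributions N :: (real ^ 'n) multiset set)) (1 / 2)
      \<and> (\<forall>Z \<in> point_distributions N :: (real ^ 'n) multiset set.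
           is_maximizer N Z \<longleftrightarrow> centrally_symmetric Z))
   \<and> (\<forall>N\<ge>1. odd N \<longrightarrow>
        is_maximum (mean_geodesic_dist ` (point_distributions N :: (real ^ 'n) multiset set))
          (1 / 2 - 1 / (2 * (real N)\<^sup>2))
      \<and> (\<forall>Z \<in> point_distributions N :: (real ^ 'n) multiset set.
           is_maximizer N Z \<longleftrightarrow>
           (\<exists>Z1 Z2. Z = Z1 + Z2 \<and> centrally_symmetric Z1
              \<and> (\<exists>V. subspace V \<and> dim V = 2 \<and> set_mset Z2 \<subseteq> V)
              \<and> mean_geodesic_dist Z2 = 1 / 2 - 1 / (2 * (real (size Z2))\<^sup>2))))"
proof (intro conjI allI ballI impI)
  have dim: "DIM(real ^ 'n) \<ge> 2" using assms by simp
  \<comment> \<open>One formula serves both parities, since the \<open>of_bool\<close> term vanishes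
    for even \<open>N\<close>.\<close>
  have max: "is_maximum (mean_geodesic_dist ` (point_distributions N :: (real ^ 'n) multiset set))
      (1 / 2 - of_bool (odd N) / (2 * (real N)\<^sup>2))" if "N \<ge> 1" for N
    using that dim by (rule is_maximum_mean_geodesic_dist)
  {
    fix N :: nat assume "N \<ge> 1" "even N"
    then show "is_maximum (mean_geodesic_dist ` (point_distributions N :: (real ^ 'n) multiset set)) (1 / 2)"
      using max[of N] by simp
  next
    fix N :: nat assume "N \<ge> 1" "odd N"
    then show "is_maximum (mean_geodesic_dist ` (point_distributions N :: (real ^ 'n) multiset set))
        (1 / 2 - 1 / (2 * (real N)\<^sup>2))"
      using max[of N] by simp
  }
  fix N :: nat and Z :: "(real ^ 'n) multiset"
  assume N: "1 \<le> N" and Z: "Z \<in> point_distributions N"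
  then have sub: "set_mset Z \<subseteq> sphere 0 1" and size: "size Z = N"
    by (auto simp: point_distributions_def)
  note maximizer = is_maximizer_iff_balanced[OF Z N dim]
  have "0 \<le> of_bool (odd N) / (2 * (real N)\<^sup>2)" by simp
  then show "mean_geodesic_dist Z \<le> 1 / 2" using mean_geodesic_dist_le(1)[OF Z N dim] by linarith
  show "is_maximizer N Z \<longleftrightarrow> (\<forall>x \<in> sphere 0 1. set_mset Z \<inter> perp_hyperplane x = {} \<longrightarrow>
           \<bar>int (size {#z \<in># Z. z \<in> open_hemisphere x#})
            - int (size {#z \<in># Z. z \<in> open_hemisphere (- x)#})\<bar> \<le> 1)"
    unfolding maximizer by (rule balanced_iff_hemispheres[OF sub])
  show "is_maximizer N Z \<longleftrightarrow> centrally_symmetric Z" if "even N"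
    unfolding maximizer using that by (intro balanced_even_iff_symmetric sub) (simp add: size)
  show "is_maximizer N Z \<longleftrightarrow> (\<exists>Z1 Z2. Z = Z1 + Z2 \<and> centrally_symmetric Z1
              \<and> (\<exists>V. subspace V \<and> dim V = 2 \<and> set_mset Z2 \<subseteq> V)
              \<and> mean_geodesic_dist Z2 = 1 / 2 - 1 / (2 * (real (size Z2))\<^sup>2))" if "odd N"
    unfolding maximizer using that by (intro balanced_odd_iff_decomposition sub dim) (simp add: size)
qed

end
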